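(* Let $(\Omega,\mathcal{A},\mathbb{P})$ be a $\sigma$-finite measure space with a flow $\{\theta_t:t\in\mathbb{R}\}$ such that $\mathbb{P}$ is stationary. Let $\xi$ and $\eta$ be invariant orthogonal diffuse random measures on $\mathbb{R}$ with finite intensities. Assume further that $$\mathbb{E}_{\mathbb{P}}\big[\xi[0,1]\,\big|\,\mathcal{I}\big]=\mathbb{E}_{\mathbb{P}}\big[\eta[0,1]\,\big|\,\mathcal{I}\big],\qquad\mathbb{P}\text{-a.e.}$$ Then the mapping $\tau$ defined by $$\tau(s):=\inf\{t>s:\ \xi[s,t]=\eta[s,t]\},\qquad s\in\mathbb{R},$$ is an allocation rule balancing $\xi$ and $\eta$.
   Context: Flow: measurable bijections $\theta_t:\Omega\to\Omega$, $t\in\mathbb{R}$, such that $(\omega,t)\mapsto\theta_t(\omega)$ is measurable, $\theta_0$ is the identity and $\theta_{s+t}=\theta_s\circ\theta_t$. Stationarity: $\mathbb{P}=\mathbb{P}\circ\theta_s$ for all $s\in\mathbb{R}$. $\mathbb{E}_{\mathbb{P}}$ is integration with respect to $\mathbb{P}$. A random measure $\xi$ on $\mathbb{R}$ is a kernel from $\Omega$ to $\mathbb{R}$ with $\xi(\omega,C)<\infty$ for $\mathbb{P}$-a.e. $\omega$ and all compact $C$. It is invariant if $\xi(\theta_t\omega,C-t)=\xi(\omega,C)$ for all Borel $C\subset\mathbb{R}$ and $t\in\mathbb{R}$, $\mathbb{P}$-a.e. Diffuse means atomless ($\mathbb{P}$-a.e.). $\xi$ and $\eta$ are orthogonal if they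 are mutually singular measures on $\mathbb{R}$, $\mathbb{P}$-a.e. The intensity of $\xi$ is $\mathbb{E}_{\mathbb{P}}\,\xi[0,1]$. Invariant $\sigma$-algebra: $\mathcal{I}:=\{A\in\mathcal{A}:\theta_tA=A\text{ for all }t\in\mathbb{R}\}$. As $\mathbb{P}$ may be infinite (and need not be $\sigma$-finite on $\mathcal{I}$), the assumed equality of conditional expectations is understood as $\mathbb{E}_{\mathbb{P}}\mathbf{1}_A\,\xi[0,1]=\mathbb{E}_{\mathbb{P}}\mathbf{1}_A\,\eta[0,1]$ for all $A\in\mathcal{I}$. An allocation rule is a measurable map $\tau:\Omega\times\mathbb{R}\to\mathbb{R}$ with $\tau(\theta_t\omega,s-t)=\tau(\omega,s)-t$ for all $s,t\in\mathbb{R}$ and $\mathbb{P}$-a.e. $\omega$. It balances $\xi$ and $\eta$ if $\int\mathbf{1}\{\tau(s)\in\cdot\}\,\xi(ds)=\eta$, $\mathbb{P}$-a.e. With $\inf\emptyset=\infty$, finiteness of the $\tau$ in the claim is understood for $\xi$-a.e. $s$, $\mathbb{P}$-a.e.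
   Formalization: Adds that ξ(R) is 0 or ∞ P-a.e. (without it the claim fails: Lebesgue P on R, shift flow, unit mass of ξ to the right of that of η); the measurability of τ is claimed only off a P-null set of ω, since local finiteness and diffuseness hold only P-a.e. *)

theory Defs
  imports "HOL-Analysis.Analysis"
begin

definition measurable_flow :: "'w measure \<Rightarrow> (real \<Rightarrow> 'w \<Rightarrow> 'w) \<Rightarrow> bool" where
  "measurable_flow P \<theta> \<longleftrightarrow>
     (\<forall>t. bij_betw (\<theta> t) (space P) (space P)) \<and>
     (\<lambda>(\<omega>, t). \<theta> t \<omega>) \<in> measurable (P \<Otimes>\<^sub>M borel) P \<and>
     (\<forall>\<omega>\<in>space P. \<theta> 0 \<omega> = \<omega>) \<and>
     (\<forall>s t. \<forall>\<omega>\<in>space P. \<theta> (s + t) \<omega> = \<theta> s (\<theta> t \<omega>))"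

definition stationary :: "'w measure \<Rightarrow> (real \<Rightarrow> 'w \<Rightarrow> 'w) \<Rightarrow> bool" where
  "stationary P \<theta> \<longleftrightarrow> (\<forall>s. \<forall>A\<in>sets P. emeasure P (\<theta> s ` A) = emeasure P A)"

definition invariant_sets :: "'w measure \<Rightarrow> (real \<Rightarrow> 'w \<Rightarrow> 'w) \<Rightarrow> 'w set set" where
  "invariant_sets P \<theta> = {A \<in> sets P. \<forall>t. \<theta> t ` A = A}"

text \<open>Only local finiteness is required up to a null set; the kernel property holds everywhere.\<close>

definition random_measure :: "'w measure \<Rightarrow> ('w \<Rightarrow> real measure) \<Rightarrow> bool" where
  "random_measure P \<xi> \<longleftrightarrow>
     (\<forall>\<omega>\<in>space P. sets (\<xi> \<omega>) = sets borel) \<and>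
     (\<forall>C\<in>sets borel. (\<lambda>\<omega>. emeasure (\<xi> \<omega>) C) \<in> borel_measurable P) \<and>
     (AE \<omega> in P. \<forall>C. compact C \<longrightarrow> emeasure (\<xi> \<omega>) C < \<infinity>)"

definition invariant_random_measure ::
    "'w measure \<Rightarrow> (real \<Rightarrow> 'w \<Rightarrow> 'w) \<Rightarrow> ('w \<Rightarrow> real measure) \<Rightarrow> bool" where
  "invariant_random_measure P \<theta> \<xi> \<longleftrightarrow>
     (AE \<omega> in P. \<forall>t. \<forall>C\<in>sets borel.
        emeasure (\<xi> (\<theta> t \<omega>)) ((\<lambda>x. x - t) ` C) = emeasure (\<xi> \<omega>) C)"

definition diffuse :: "'w measure \<Rightarrow> ('w \<Rightarrow> real measure) \<Rightarrow> bool" where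
  "diffuse P \<xi> \<longleftrightarrow> (AE \<omega> in P. \<forall>x. emeasure (\<xi> \<omega>) {x} = 0)"

definition orthogonal_measures ::
    "'w measure \<Rightarrow> ('w \<Rightarrow> real measure) \<Rightarrow> ('w \<Rightarrow> real measure) \<Rightarrow> bool" where
  "orthogonal_measures P \<xi> \<eta> \<longleftrightarrow>
     (AE \<omega> in P. \<exists>C\<in>sets borel. emeasure (\<xi> \<omega>) C = 0 \<and> emeasure (\<eta> \<omega>) (- C) = 0)"

definition intensity :: "'w measure \<Rightarrow> ('w \<Rightarrow> real measure) \<Rightarrow> ennreal" where
  "intensity P \<xi> = (\<integral>\<^sup>+ \<omega>. emeasure (\<xi> \<omega>) {0..1} \<partial>P)"

text \<open>
  Equality of the conditional expectations of \<open>\<xi>[0,1]\<close> and \<open>\<eta>[0,1]\<close> given the invariant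
  \<open>\<sigma>\<close>-algebra. The measure \<open>P\<close> need not be \<open>\<sigma>\<close>-finite on that \<open>\<sigma>\<close>-algebra, so the equality is
  expressed by integrals over invariant sets.
\<close>

definition equal_conditional_intensities ::
    "'w measure \<Rightarrow> (real \<Rightarrow> 'w \<Rightarrow> 'w) \<Rightarrow> ('w \<Rightarrow> real measure) \<Rightarrow> ('w \<Rightarrow> real measure) \<Rightarrow> bool" where
  "equal_conditional_intensities P \<theta> \<xi> \<eta> \<longleftrightarrow>
     (\<forall>A\<in>invariant_sets P \<theta>.
        (\<integral>\<^sup>+ \<omega>. indicator A \<omega> * emeasure (\<xi> \<omega>) {0..1} \<partial>P) =
        (\<integral>\<^sup>+ \<omega>. indicator A \<omega> * emeasure (\<eta> \<omega>) {0..1} \<partial>P))"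

text \<open>
  Allocation rules take values in the extended reals because the infimum in \<open>matching_time\<close> may be
  over the empty set.

  Measurability is required after removal of a \<open>P\<close>-null set of \<open>\<omega>\<close>. Local finiteness and
  diffuseness hold only almost everywhere, and on the exceptional null set \<open>matching_time\<close> need not
  be measurable. For instance, let the flow be trivial and let \<open>\<omega>\<close> range over the compact
  \<open>K \<subseteq> [0,1]\<close> with \<open>0 \<in> K\<close>, with \<open>P = 0\<close>. For each bounded gap \<open>(l,r)\<close> of \<open>K\<close> let \<open>\<xi>\<close> have an
  atom of mass \<open>r - l\<close> at \<open>l\<close>, and let \<open>\<eta>\<close> be Lebesgue measure on the union of these gaps.
  Then \<open>\<xi>[0,t] = \<eta>[0,t]\<close> for \<open>t\<close> in \<open>(0, max K)\<close> exactly if \<open>t \<in> K\<close> is a limit of \<open>K\<close> from the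
  right, and the compact sets having such a point do not form a Borel set.
\<close>

definition allocation_rule ::
    "'w measure \<Rightarrow> (real \<Rightarrow> 'w \<Rightarrow> 'w) \<Rightarrow> ('w \<Rightarrow> real \<Rightarrow> ereal) \<Rightarrow> bool" where
  "allocation_rule P \<theta> \<tau> \<longleftrightarrow>
     (\<exists>N\<in>null_sets P.
        (\<lambda>(\<omega>, s). \<tau> \<omega> s) \<in> borel_measurable (restrict_space P (space P - N) \<Otimes>\<^sub>M borel)) \<and>
     (AE \<omega> in P. \<forall>s t. \<tau> (\<theta> t \<omega>) (s - t) = \<tau> \<omega> s - ereal t)"

definition balances ::
    "'w measure \<Rightarrow> ('w \<Rightarrow> real \<Rightarrow> ereal) \<Rightarrow> ('w \<Rightarrow> real measure) \<Rightarrow> ('w \<Rightarrow> real measure) \<Rightarrow> bool" where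
  "balances P \<tau> \<xi> \<eta> \<longleftrightarrow>
     (AE \<omega> in P. \<forall>C\<in>sets borel.
        (\<integral>\<^sup>+ s. indicator (ereal ` C) (\<tau> \<omega> s) \<partial>\<xi> \<omega>) = emeasure (\<eta> \<omega>) C)"

definition matching_time ::
    "('w \<Rightarrow> real measure) \<Rightarrow> ('w \<Rightarrow> real measure) \<Rightarrow> 'w \<Rightarrow> real \<Rightarrow> ereal" where
  "matching_time \<xi> \<eta> \<omega> s =
     Inf (ereal ` {t. t > s \<and> emeasure (\<xi> \<omega>) {s..t} = emeasure (\<eta> \<omega>) {s..t}})"

text \<open>
  This condition on the total mass excludes dissipative parts of the flow on which \<open>\<xi>\<close> is
  nonzero. It follows from the invariance of \<open>\<xi>\<close> if \<open>P\<close> is finite, or if \<open>P\<close> is \<open>\<sigma>\<close>-finite on the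
  invariant \<open>\<sigma>\<close>-algebra. It cannot be dropped for general \<open>\<sigma>\<close>-finite \<open>P\<close>: let \<open>P\<close> be Lebesgue
  measure on the line, \<open>\<theta>\<^sub>t \<omega> = \<omega> + t\<close>, and let \<open>\<xi>(\<omega>,\<cdot>)\<close> and \<open>\<eta>(\<omega>,\<cdot>)\<close> be Lebesgue measure on
  \<open>[2-\<omega>, 3-\<omega>]\<close> and \<open>[-\<omega>, 1-\<omega>]\<close>. Both intensities are 1, the only invariant sets are the empty set
  and the whole line, and \<open>matching_time\<close> is infinite \<open>\<xi>\<close>-almost everywhere.
\<close>

definition zero_or_infinite_mass :: "'w measure \<Rightarrow> ('w \<Rightarrow> real measure) \<Rightarrow> bool" where
  "zero_or_infinite_mass P \<xi> \<longleftrightarrow> (AE \<omega> in P. emeasure (\<xi> \<omega>) UNIV \<in> {0, \<infinity>})"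

end

theory Submission
  imports Defs
begin

text \<open>
  Let \<open>F(t) = \<xi>[0,t] - \<eta>[0,t]\<close>, with the usual sign convention for negative \<open>t\<close>. As \<open>\<xi>\<close> and \<open>\<eta>\<close> are
  mutually singular, \<open>\<xi>\<close>-almost every \<open>s\<close> in \<open>(a,b)\<close> that is not matched up to \<open>b\<close> is the strict minimum
  point of \<open>F\<close> on \<open>[s,b]\<close>, and these points have \<open>\<xi>\<close>-mass \<open>F(b) - min\<^bsub>[a,b]\<^esub> F\<close>. Hence \<open>\<tau>\<close> is finite
  and transports \<open>\<xi>\<close> to \<open>\<eta>\<close> as soon as the losses \<open>min\<^bsub>[a',b]\<^esub> F - min\<^bsub>[a,b]\<^esub> F\<close> of \<open>\<xi>\<close> and
  \<open>min\<^bsub>[a,b]\<^esub> F - min\<^bsub>[a,b']\<^esub> F\<close> of \<open>\<eta>\<close> vanish for \<open>b \<rightarrow> \<infinity>\<close> and \<open>a \<rightarrow> -\<infinity>\<close>, respectively.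

  By stationarity and the equality of the conditional intensities, both losses on \<open>[0,1]\<close> have the same
  integral over every invariant event. Suppose that \<open>\<xi>\<close> loses mass. The event that there is a first
  integer time of loss is null, since its translates are disjoint while \<open>\<xi>\<close> has infinite total mass and
  finite intensity. But a loss of \<open>\<xi>\<close> excludes any later loss of \<open>\<eta>\<close>; so if losses of \<open>\<xi>\<close> occur
  arbitrarily early, then \<open>\<eta>\<close> loses nothing, and by the equality of the integrals neither does \<open>\<xi>\<close>. So \<open>\<xi>\<close>
  almost never loses mass, and by the same equality neither does \<open>\<eta>\<close>.
\<close>

subsection \<open>Diffuse measures on the line\<close>

locale diffuse_radon =
  fixes \<mu> :: "real measure"
  assumes sets_eq [measurable_cong, simp]: "sets \<mu> = sets borel"
    and Icc_finite: "emeasure \<mu> {a..b} < \<infinity>"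
    and point_null [simp]: "emeasure \<mu> {x} = 0"
begin

lemma space_eq [simp]: "space \<mu> = UNIV"
  using sets_eq_imp_space_eq[OF sets_eq] by simp

lemma bounded_finite: "A \<subseteq> {a..b} \<Longrightarrow> emeasure \<mu> A < \<infinity>"
  by (rule le_less_trans[OF emeasure_mono Icc_finite]) auto

lemma outer_open:
  assumes E: "E \<in> sets borel" "E \<subseteq> {a..b}" and e: "e > 0"
  obtains U where "open U" "E \<subseteq> U" "emeasure \<mu> U \<le> emeasure \<mu> E + ennreal e"
proof -
  \<comment> \<open>Outer regularity is applied to the finite restriction of \<open>\<mu>\<close> to
    this window. The window is open, so cutting \<open>U\<close> down to it leaves an open
    set.\<close>
  let ?S = "{a-1<..<b+1}"
  let ?M = "density \<mu> (indicator ?S)"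
  have "?S \<subseteq> {a-1..b+1}" by auto
  then have fin: "emeasure ?M (space ?M) \<noteq> \<infinity>"
    using bounded_finite[of ?S "a-1" "b+1"] by (simp add: emeasure_restricted)
  have M: "emeasure ?M X = emeasure \<mu> (?S \<inter> X)" if "X \<in> sets borel" for X
    using that by (auto simp: emeasure_restricted)
  have "emeasure ?M E < emeasure ?M E + ennreal e"
    using e E bounded_finite[of "?S \<inter> E" a b]
    by (simp add: M ennreal_add_left_cancel_less[where b = 0, simplified] le_infI2)
  then have "(INF U \<in> {U. E \<subseteq> U \<and> open U}. emeasure ?M U) < emeasure ?M E + ennreal e"
    using outer_regular[of ?M E] fin E by simp
  then obtain U where U: "E \<subseteq> U" "open U" "emeasure ?M U < emeasure ?M E + ennreal e"
    unfolding INF_less_iff by auto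
  show ?thesis
  proof
    show "open (?S \<inter> U)" using U by auto
    show "E \<subseteq> ?S \<inter> U" using U E by auto
    have "?S \<inter> E = E" using E by auto
    then show "emeasure \<mu> (?S \<inter> U) \<le> emeasure \<mu> E + ennreal e"
      using U E by (simp add: M)
  qed
qed

lemma inner_compact:
  assumes E: "E \<in> sets borel" "E \<subseteq> {a..b}" and e: "e > 0"
  obtains K where "compact K" "K \<subseteq> E" "emeasure \<mu> E \<le> emeasure \<mu> K + ennreal e"
proof (cases "emeasure \<mu> E = 0")
  case True
  then show ?thesis using that[of "{}"] by auto
next
  case False
  let ?M = "density \<mu> (indicator {a..b})"
  have fin: "emeasure ?M (space ?M) \<noteq> \<infinity>"
    using Icc_finite[of a b] by (auto simp: emeasure_restricted)
  have M: "emeasure ?M X = emeasure \<mu> ({a..b} \<inter> X)" if "X \<in> sets borel" for X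
    using that by (auto simp: emeasure_restricted)
  have EE: "{a..b} \<inter> E = E" using E by auto
  \<comment> \<open>Strict because the mass of \<open>E\<close> is finite and, in this case,
    positive; for a null set truncated subtraction would give equality.\<close>
  have "emeasure ?M E - ennreal e < emeasure ?M E"
    using False e E bounded_finite[OF E(2)]
    by (subst (1 2) M) (auto simp: EE less_top[symmetric] zero_less_iff_neq_zero intro!: ennreal_between)
  then have "emeasure ?M E - ennreal e < (SUP K \<in> {K. K \<subseteq> E \<and> compact K}. emeasure ?M K)"
    using inner_regular[of ?M E] fin E by simp
  then obtain K where K: "K \<subseteq> E" "compact K" "emeasure ?M E - ennreal e < emeasure ?M K"
    unfolding less_SUP_iff by auto
  show ?thesis
  proof
    show "compact K" "K \<subseteq> E" by fact+
    have "{a..b} \<inter> K = K" using K E by auto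
    then have "emeasure \<mu> E - ennreal e < emeasure \<mu> K"
      using K E by (simp add: M EE borel_compact)
    then show "emeasure \<mu> E \<le> emeasure \<mu> K + ennreal e"
      using ennreal_minus_le_iff[of "emeasure \<mu> E" "ennreal e" "emeasure \<mu> K"] 
      by (simp add: less_imp_le add.commute)
  qed
qed

end

section \<open>Comparing measures through intervals with endpoints in a given set\<close>

text \<open>Some \<open>e\<close>-neighbourhood of \<open>K\<close> stays inside \<open>U\<close>.
  With mesh \<open>e / 2\<close>, a closed cell that meets \<open>K\<close> in \<open>x\<close> lies
  in the ball of radius \<open>e\<close> about \<open>x\<close>, and boundedness of \<open>K\<close>
  leaves only finitely many such cells.\<close>

lemma compact_grid_cover:
  fixes K U :: "real set"
  assumes "compact K" "open U" "K \<subseteq> U"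
  obtains I :: "int set" and d :: real where "finite I" "d > 0"
    "K \<subseteq> (\<Union>k\<in>I. {of_int k * d..<of_int (k + 1) * d})"
    "\<And>k. k \<in> I \<Longrightarrow> K \<inter> {of_int k * d..<of_int (k + 1) * d} \<noteq> {}"
    "\<And>k. k \<in> I \<Longrightarrow> {of_int k * d..of_int (k + 1) * d} \<subseteq> U"
proof -
  obtain e where e: "e > 0" "(\<Union>x\<in>K. ball x e) \<subseteq> U"
    using compact_subset_open_imp_ball_epsilon_subset[OF assms] .
  define d where "d = e / 2"
  have d: "d > 0" using e by (simp add: d_def)
  define I where "I = (\<lambda>x. \<lfloor>x / d\<rfloor>) ` K"
  have cell: "x \<in> {of_int \<lfloor>x / d\<rfloor> * d..<of_int (\<lfloor>x / d\<rfloor> + 1) * d}" for x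
    using d floor_divide_lower[of d x] floor_divide_upper[of d x] by simp
  obtain R where R: "\<And>x. x \<in> K \<Longrightarrow> \<bar>x\<bar> \<le> R"
    using compact_imp_bounded[OF \<open>compact K\<close>] by (auto simp: bounded_iff)
  have "I \<subseteq> {\<lfloor>-R / d\<rfloor>..\<lfloor>R / d\<rfloor>}"
  proof
    fix k assume "k \<in> I"
    then obtain x where x: "x \<in> K" "k = \<lfloor>x / d\<rfloor>" by (auto simp: I_def)
    have "-R / d \<le> x / d" "x / d \<le> R / d"
      using R[OF x(1)] d by (intro divide_right_mono; linarith)+
    then show "k \<in> {\<lfloor>-R / d\<rfloor>..\<lfloor>R / d\<rfloor>}" using x by (auto intro: floor_mono)
  qed
  then have "finite I" by (rule finite_subset) simp
  show ?thesis
  proof (rule that[of I d])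
    show "finite I" "d > 0" by fact+
    show "K \<subseteq> (\<Union>k\<in>I. {of_int k * d..<of_int (k + 1) * d})"
      using cell by (force simp: I_def)
    fix k assume "k \<in> I"
    then obtain x where x: "x \<in> K" "k = \<lfloor>x / d\<rfloor>" by (auto simp: I_def)
    show "K \<inter> {of_int k * d..<of_int (k + 1) * d} \<noteq> {}"
      using cell[of x] x by blast
    have "{of_int k * d..of_int (k + 1) * d} \<subseteq> ball x e"
    proof
      fix y assume y: "y \<in> {of_int k * d..of_int (k + 1) * d}"
      have "\<bar>x - y\<bar> \<le> d"
        using y cell[of x] x(2) by (simp add: algebra_simps abs_le_iff)
      then show "y \<in> ball x e" using e d_def by (simp add: dist_real_def)
    qed
    then show "{of_int k * d..of_int (k + 1) * d} \<subseteq> U" using e x by blast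
  qed
qed

text \<open>Within a grid cell, \<open>K\<close> is contained in the interval from its least to its
  greatest point there. By compactness both points belong to \<open>K\<close>, so the hypothesis
  applies to this interval. Summing over the cells costs at most the mass of
  \<open>U\<close>.\<close>

lemma emeasure_le_if_hulls_le_compact:
  fixes \<mu> \<nu>1 \<nu>2 :: "real measure"
  assumes "diffuse_radon \<mu>" "diffuse_radon \<nu>1" "diffuse_radon \<nu>2"
    and K: "compact K" "open U" "K \<subseteq> U"
    and hull: "\<And>s t. s \<in> K \<Longrightarrow> t \<in> K \<Longrightarrow> s \<le> t \<Longrightarrow>
      emeasure \<mu> {s..t} \<le> emeasure \<nu>1 {s..t} + emeasure \<nu>2 {s..t}"
  shows "emeasure \<mu> K \<le> emeasure \<nu>1 U + emeasure \<nu>2 U"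
proof -
  interpret mu: diffuse_radon \<mu> by fact
  interpret n1: diffuse_radon \<nu>1 by fact
  interpret n2: diffuse_radon \<nu>2 by fact
  obtain I :: "int set" and d :: real where I: "finite I" "d > 0"
    "K \<subseteq> (\<Union>k\<in>I. {of_int k * d..<of_int (k + 1) * d})"
    "\<And>k. k \<in> I \<Longrightarrow> K \<inter> {of_int k * d..<of_int (k + 1) * d} \<noteq> {}"
    "\<And>k. k \<in> I \<Longrightarrow> {of_int k * d..of_int (k + 1) * d} \<subseteq> U"
    using compact_grid_cover[OF K] by blast
  define J where "J k = {of_int k * d..<of_int (k + 1) * d}" for k :: int
  define J' where "J' k = {of_int k * d..of_int (k + 1) * d}" for k :: int
  have disj: "disjoint_family_on J I"
  unfolding disjoint_family_on_def
  proof (intro ballI impI)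
    fix k l :: int assume "k \<noteq> l"
    have "\<lfloor>x / d\<rfloor> = k" if "x \<in> J k" for x k
      using that I(2) unfolding J_def by (auto simp: floor_eq_iff field_simps)
    then show "J k \<inter> J l = {}" using \<open>k \<noteq> l\<close> by blast
  qed
  \<comment> \<open>Closed cells keep the pieces of \<open>K\<close> compact, half-open cells are
    disjoint; the two differ by a null point.\<close>
  have JJ': "emeasure \<nu> (J' k) \<le> emeasure \<nu> (J k)" if "diffuse_radon \<nu>" for \<nu> k
  proof -
    interpret diffuse_radon \<nu> by fact
    have "of_int k * d \<le> of_int (k + 1) * d" using I(2) by (simp add: algebra_simps)
    then have "J' k = J k \<union> {of_int (k + 1) * d}" unfolding J_def J'_def by auto
    then have "emeasure \<nu> (J' k) \<le> emeasure \<nu> (J k) + emeasure \<nu> {of_int (k + 1) * d}"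
      unfolding J_def by (simp only: emeasure_subadditive[of _ \<nu>, unfolded sets_eq] atLeastLessThan_borel borel_singleton sets.empty_sets)
    then show ?thesis by (simp only: point_null add_0_right)
  qed
  have sumU: "(\<Sum>k\<in>I. emeasure \<nu> (J k)) \<le> emeasure \<nu> U" if "diffuse_radon \<nu>" for \<nu>
  proof -
    interpret diffuse_radon \<nu> by fact
    have "(\<Sum>k\<in>I. emeasure \<nu> (J k)) = emeasure \<nu> (\<Union>k\<in>I. J k)"
      using I(1) by (intro sum_emeasure disj) (auto simp: J_def)
    also have "\<dots> \<le> emeasure \<nu> U"
    proof (rule emeasure_mono)
      have "J k \<subseteq> U" if "k \<in> I" for k
      proof -
        have "J k \<subseteq> J' k" unfolding J_def J'_def by auto
        also have "J' k \<subseteq> U" using I(5)[OF that] unfolding J'_def .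
        finally show ?thesis .
      qed
      then show "(\<Union>k\<in>I. J k) \<subseteq> U" by blast
    qed (use K in simp)
    finally show ?thesis .
  qed
  have cell: "emeasure \<mu> (K \<inter> J' k) \<le> emeasure \<nu>1 (J k) + emeasure \<nu>2 (J k)" if k: "k \<in> I" for k
  proof -
    have c: "compact (K \<inter> J' k)" using K by (auto simp: J'_def compact_Int)
    have ne: "K \<inter> J' k \<noteq> {}" using I(4)[OF k] by (auto simp: J'_def) 
    obtain s where s: "s \<in> K \<inter> J' k" "\<And>x. x \<in> K \<inter> J' k \<Longrightarrow> s \<le> x"
      using compact_attains_inf[OF c ne] by blast
    obtain t where t: "t \<in> K \<inter> J' k" "\<And>x. x \<in> K \<inter> J' k \<Longrightarrow> x \<le> t"
      using compact_attains_sup[OF c ne] by blast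
    have sub: "{s..t} \<subseteq> J' k" using s(1) t(1) by (auto simp: J'_def)
    have "emeasure \<mu> (K \<inter> J' k) \<le> emeasure \<mu> {s..t}"
      using s t by (intro emeasure_mono) auto
    also have "\<dots> \<le> emeasure \<nu>1 {s..t} + emeasure \<nu>2 {s..t}"
      using s t by (intro hull) auto
    also have "\<dots> \<le> emeasure \<nu>1 (J' k) + emeasure \<nu>2 (J' k)"
      using sub by (intro add_mono emeasure_mono) (auto simp: J'_def)
    also have "\<dots> \<le> emeasure \<nu>1 (J k) + emeasure \<nu>2 (J k)"
      by (intro add_mono JJ' assms)
    finally show ?thesis .
  qed
  have Ks: "K \<inter> J' k \<in> sets borel" for k
    using borel_compact[OF K(1)] by (simp add: J'_def)
  have "emeasure \<mu> K \<le> emeasure \<mu> (\<Union>k\<in>I. K \<inter> J' k)"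
  proof (rule emeasure_mono)
    show "K \<subseteq> (\<Union>k\<in>I. K \<inter> J' k)"
    proof
      fix x assume x: "x \<in> K"
      obtain k where k: "k \<in> I" "x \<in> J k"
        using subsetD[OF I(3) x] unfolding J_def by blast
      then have "x \<in> J' k" unfolding J_def J'_def by simp
      with x k(1) show "x \<in> (\<Union>k\<in>I. K \<inter> J' k)" by blast
    qed
    show "(\<Union>k\<in>I. K \<inter> J' k) \<in> sets \<mu>"
      using I(1) Ks by (intro sets.finite_UN) auto
  qed
  also have "\<dots> \<le> (\<Sum>k\<in>I. emeasure \<mu> (K \<inter> J' k))"
    using I(1) Ks by (intro emeasure_subadditive_finite) auto
  also have "\<dots> \<le> (\<Sum>k\<in>I. emeasure \<nu>1 (J k) + emeasure \<nu>2 (J k))"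
    by (intro sum_mono cell)
  also have "\<dots> \<le> emeasure \<nu>1 U + emeasure \<nu>2 U"
    unfolding sum.distrib by (intro add_mono sumU assms)
  finally show ?thesis .
qed

text \<open>Regularity passes from compact sets to Borel sets. The point is that only intervals with
  both endpoints in \<open>E\<close> are tested: an inequality between increments that holds merely
  along \<open>E\<close> becomes an inequality of measures on \<open>E\<close>.\<close>

lemma emeasure_le_if_hulls_le:
  fixes \<mu> \<nu>1 \<nu>2 :: "real measure"
  assumes "diffuse_radon \<mu>" "diffuse_radon \<nu>1" "diffuse_radon \<nu>2"
    and E: "E \<in> sets borel" "E \<subseteq> {a..b}"
    and hull: "\<And>s t. s \<in> E \<Longrightarrow> t \<in> E \<Longrightarrow> s \<le> t \<Longrightarrow>
      emeasure \<mu> {s..t} \<le> emeasure \<nu>1 {s..t} + emeasure \<nu>2 {s..t}"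
  shows "emeasure \<mu> E \<le> emeasure \<nu>1 E + emeasure \<nu>2 E"
proof (rule ennreal_le_epsilon)
  interpret mu: diffuse_radon \<mu> by fact
  interpret n1: diffuse_radon \<nu>1 by fact
  interpret n2: diffuse_radon \<nu>2 by fact
  fix e :: real assume "e > 0"
  \<comment> \<open>One third for each of the approximations \<open>K\<close>, \<open>U1\<close> and
    \<open>U2\<close>.\<close>
  then have e: "e / 3 > 0" by simp
  obtain K where K: "compact K" "K \<subseteq> E" "emeasure \<mu> E \<le> emeasure \<mu> K + ennreal (e / 3)"
    using mu.inner_compact[OF E e] .
  obtain U1 where U1: "open U1" "E \<subseteq> U1" "emeasure \<nu>1 U1 \<le> emeasure \<nu>1 E + ennreal (e / 3)"
    using n1.outer_open[OF E e] .
  obtain U2 where U2: "open U2" "E \<subseteq> U2" "emeasure \<nu>2 U2 \<le> emeasure \<nu>2 E + ennreal (e / 3)"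
    using n2.outer_open[OF E e] .
  have "emeasure \<mu> K \<le> emeasure \<nu>1 (U1 \<inter> U2) + emeasure \<nu>2 (U1 \<inter> U2)"
    by (rule emeasure_le_if_hulls_le_compact[OF assms(1-3) K(1)])
      (use K(2) U1(1,2) U2(1,2) hull in blast)+
  also have "\<dots> \<le> emeasure \<nu>1 U1 + emeasure \<nu>2 U2"
    using U1(1) U2(1) by (intro add_mono emeasure_mono) (auto intro: borel_open)
  also have "\<dots> \<le> (emeasure \<nu>1 E + ennreal (e / 3)) + (emeasure \<nu>2 E + ennreal (e / 3))"
    by (intro add_mono U1 U2)
  finally have "emeasure \<mu> K + ennreal (e / 3) \<le>
      (emeasure \<nu>1 E + ennreal (e / 3)) + (emeasure \<nu>2 E + ennreal (e / 3)) + ennreal (e / 3)"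
    by (rule add_right_mono)
  with K(3) have "emeasure \<mu> E \<le>
      (emeasure \<nu>1 E + ennreal (e / 3)) + (emeasure \<nu>2 E + ennreal (e / 3)) + ennreal (e / 3)"
    by (rule order_trans)
  also have "\<dots> = emeasure \<nu>1 E + emeasure \<nu>2 E + (ennreal (e / 3) + ennreal (e / 3) + ennreal (e / 3))"
    by (simp add: ac_simps)
  also have "ennreal (e / 3) + ennreal (e / 3) + ennreal (e / 3) = ennreal e"
    using \<open>e > 0\<close> by (simp flip: ennreal_plus)
  finally show "emeasure \<mu> E \<le> emeasure \<nu>1 E + emeasure \<nu>2 E + ennreal e" .
qed

section \<open>Distribution functions\<close>

definition cumul :: "real measure \<Rightarrow> real \<Rightarrow> real" where
  "cumul \<mu> t = (if 0 \<le> t then measure \<mu> {0..t} else - measure \<mu> {t..0})"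

context diffuse_radon
begin

lemma emeasure_Icc: "emeasure \<mu> {a..b} = ennreal (measure \<mu> {a..b})"
  using Icc_finite[of a b] by (intro emeasure_eq_ennreal_measure) auto

lemma measure_Icc_split:
  assumes "a \<le> b" "b \<le> c"
  shows "measure \<mu> {a..c} = measure \<mu> {a..b} + measure \<mu> {b..c}"
proof -
  have "emeasure \<mu> {a..c} = emeasure \<mu> ({a..b} \<union> ({b..c} - {b}))"
    using assms by (intro arg_cong[where f = "emeasure \<mu>"]) auto
  also have "\<dots> = emeasure \<mu> {a..b} + emeasure \<mu> ({b..c} - {b})"
    by (rule plus_emeasure[symmetric]) auto
  also have "emeasure \<mu> ({b..c} - {b}) = emeasure \<mu> {b..c}"
    by (rule emeasure_Diff_null_set) (auto simp: null_sets_def)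
  finally show ?thesis
    by (simp add: emeasure_Icc flip: ennreal_plus)
qed

lemma cumul_diff:
  assumes "a \<le> b"
  shows "cumul \<mu> b - cumul \<mu> a = measure \<mu> {a..b}"
proof -
  have z: "measure \<mu> {0} = 0" by (simp add: measure_def)
  consider "0 \<le> a" | "a < 0" "0 \<le> b" | "b < 0" using assms by linarith
  then show ?thesis
  proof cases
    case 1
    then show ?thesis using assms measure_Icc_split[of 0 a b] by (simp add: cumul_def)
  next
    case 2
    then show ?thesis using assms measure_Icc_split[of a 0 b] by (simp add: cumul_def)
  next
    case 3
    then show ?thesis using assms measure_Icc_split[of a b 0] by (simp add: cumul_def)
  qed
qed

lemma emeasure_Icc_cumul: "a \<le> b \<Longrightarrow> emeasure \<mu> {a..b} = ennreal (cumul \<mu> b - cumul \<mu> a)"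
  by (simp add: cumul_diff emeasure_Icc)

lemma cumul_mono: "a \<le> b \<Longrightarrow> cumul \<mu> a \<le> cumul \<mu> b"
  using cumul_diff[of a b] measure_nonneg[of \<mu> "{a..b}"] by linarith

lemma isCont_cumul: "isCont (cumul \<mu>) x"
  unfolding continuous_at_eps_delta
proof (intro allI impI)
  fix e :: real assume e: "e > 0"
  \<comment> \<open>Continuity from above along these intervals, which shrink to the null set
    \<open>{x}\<close>; this is where the absence of atoms enters.\<close>
  define A where "A n = {x - 1 / real (Suc n) .. x + 1 / real (Suc n)}" for n
  have anti: "decseq A"
    unfolding A_def by (intro decseq_SucI) (auto simp: field_simps intro: order_trans)
  have "(\<Inter>n. A n) = {x}"
  proof (intro equalityI subsetI)
    fix y assume "y \<in> (\<Inter>n. A n)"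
    then have y: "\<bar>y - x\<bar> \<le> 1 / real (Suc n)" for n by (simp add: A_def abs_le_iff algebra_simps)
    have "(\<lambda>n. 1 / real (Suc n)) \<longlonglongrightarrow> 0" using LIMSEQ_inverse_real_of_nat by (simp add: inverse_eq_divide)
    then have "\<bar>y - x\<bar> \<le> 0"
      using y by (intro LIMSEQ_le_const) auto
    then show "y \<in> {x}" by simp
  qed (auto simp: A_def)
  moreover have "range A \<subseteq> sets \<mu>" by (auto simp: A_def)
  moreover have "emeasure \<mu> (A n) \<noteq> \<infinity>" for n
    using Icc_finite unfolding A_def by (metis less_irrefl)
  ultimately have "(\<lambda>n. emeasure \<mu> (A n)) \<longlonglongrightarrow> 0"
    using Lim_emeasure_decseq[of A \<mu>] anti by simp
  then have "\<forall>\<^sub>F n in sequentially. emeasure \<mu> (A n) < ennreal e"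
    using e by (intro order_tendstoD) auto
  then obtain n where n: "emeasure \<mu> (A n) < ennreal e"
    by (auto simp: eventually_sequentially)
  have lt: "\<bar>cumul \<mu> y - cumul \<mu> x\<bar> < e" if "\<bar>y - x\<bar> < 1 / real (Suc n)" for y
  proof -
    have "emeasure \<mu> {min x y..max x y} \<le> emeasure \<mu> (A n)"
      using that by (intro emeasure_mono) (auto simp: A_def abs_less_iff)
    with n have "ennreal (cumul \<mu> (max x y) - cumul \<mu> (min x y)) < ennreal e"
      by (simp add: emeasure_Icc_cumul)
    then show ?thesis
      using cumul_mono[of "min x y" "max x y"] by (auto simp: ennreal_less_iff max_def min_def split: if_splits)
  qed
  show "\<exists>d>0. \<forall>y. dist y x < d \<longrightarrow> dist (cumul \<mu> y) (cumul \<mu> x) < e"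
    by (rule exI[of _ "1 / real (Suc n)"]) (auto simp: dist_real_def lt)
qed

end

section \<open>Running minima of continuous functions\<close>

definition run_min :: "(real \<Rightarrow> real) \<Rightarrow> real \<Rightarrow> real \<Rightarrow> real" where
  "run_min f a b = Inf (f ` {a..b})"

locale cont_fun =
  fixes f :: "real \<Rightarrow> real"
  assumes cont: "isCont f x"
begin

lemma cont_on [simp, intro]: "continuous_on S f"
  using cont by (simp add: continuous_at_imp_continuous_on)

lemma run_min_attained:
  assumes "a \<le> b"
  obtains t where "t \<in> {a..b}" "run_min f a b = f t" "\<And>s. s \<in> {a..b} \<Longrightarrow> f t \<le> f s"
proof -
  obtain t where t: "t \<in> {a..b}" "\<And>s. s \<in> {a..b} \<Longrightarrow> f t \<le> f s"
    using continuous_attains_inf[of "{a..b}" f] assms by auto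
  then have "run_min f a b = f t"
    unfolding run_min_def by (intro cInf_eq_minimum) auto
  with t that show ?thesis by blast
qed

lemma run_min_le: "s \<in> {a..b} \<Longrightarrow> run_min f a b \<le> f s"
  using run_min_attained[of a b] by (metis atLeastAtMost_iff order_trans)

lemma le_run_min: "a \<le> b \<Longrightarrow> (\<And>s. s \<in> {a..b} \<Longrightarrow> c \<le> f s) \<Longrightarrow> c \<le> run_min f a b"
  using run_min_attained[of a b] by metis

lemma run_min_split:
  assumes "a \<le> b" "b \<le> c"
  shows "run_min f a c = min (run_min f a b) (run_min f b c)"
proof (rule antisym)
  show "run_min f a c \<le> min (run_min f a b) (run_min f b c)"
    using assms by (auto intro!: le_run_min run_min_le)
  show "min (run_min f a b) (run_min f b c) \<le> run_min f a c"
  proof (rule le_run_min)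
    fix s assume "s \<in> {a..c}"
    then show "min (run_min f a b) (run_min f b c) \<le> f s"
      using run_min_le[of s a b] run_min_le[of s b c] by (cases "s \<le> b") auto
  qed (use assms in auto)
qed

lemma run_min_mono_left: "a \<le> a' \<Longrightarrow> a' \<le> b \<Longrightarrow> run_min f a b \<le> run_min f a' b"
  using run_min_split[of a a' b] by simp

lemma run_min_antimono_right: "a \<le> b \<Longrightarrow> b \<le> b' \<Longrightarrow> run_min f a b' \<le> run_min f a b"
  using run_min_split[of a b b'] by simp

lemma run_min_single [simp]: "run_min f a a = f a"
  by (simp add: run_min_def)

text \<open>The difference is the positive part of \<open>run_min f a' b - run_min f a a'\<close>,
  and increasing \<open>b\<close> can only lower the first term.\<close>

lemma run_min_diff_antimono:
  assumes "a \<le> a'" "a' \<le> b" "b \<le> b'"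
  shows "run_min f a' b' - run_min f a b' \<le> run_min f a' b - run_min f a b"
  using run_min_split[of a b b'] run_min_split[of a' b b'] run_min_mono_left[of a a' b] assms
  by (simp add: min_def split: if_splits)

end

subsection \<open>Strict running minima of the difference\<close>

definition net :: "real measure \<Rightarrow> real measure \<Rightarrow> real \<Rightarrow> real" where
  "net \<mu> \<nu> t = cumul \<mu> t - cumul \<nu> t"

text \<open>Seen backwards from \<open>b\<close>, these are the times at which the path reaches a
  strict new minimum. The endpoints are left out, which changes nothing for diffuse
  measures.\<close>

definition records :: "(real \<Rightarrow> real) \<Rightarrow> real \<Rightarrow> real \<Rightarrow> real set" where
  "records f a b = {s \<in> {a<..<b}. \<forall>t\<in>{s<..b}. f s < f t}"

context cont_fun
begin

lemma run_min_records: "s \<in> records f a b \<Longrightarrow> run_min f s b = f s"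
  using run_min_attained[of s b] unfolding records_def
  by (smt (verit) atLeastAtMost_iff greaterThanAtMost_iff greaterThanLessThan_iff mem_Collect_eq)

lemma records_mono: "s \<in> records f a b \<Longrightarrow> t \<in> records f a b \<Longrightarrow> s \<le> t \<Longrightarrow> f s \<le> f t"
  by (cases "s = t") (auto simp: records_def intro: less_imp_le)

text \<open>Writes the non-records as a countable union of pieces on which
  \<open>run_min f s b\<close> is constant in \<open>s\<close>. This gives measurability of the
  records, and it shows that a measure with distribution function \<open>run_min f s b\<close>
  ignores the non-records.\<close>

lemma records_eq:
  "records f a b = {a<..<b} - (\<Union>q\<in>\<rat> \<inter> {a..b}. {s \<in> {a<..<q}. run_min f s b = run_min f q b})"
    (is "_ = ?R")
proof (intro equalityI subsetI)
  fix s assume s: "s \<in> records f a b"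
  have ne: "run_min f s b \<noteq> run_min f q b" if q: "s < q" "q \<le> b" for q
  proof -
    obtain t where "t \<in> {q..b}" "run_min f q b = f t" using run_min_attained[OF q(2)] by metis
    then show ?thesis using s q run_min_records[OF s] by (auto simp: records_def)
  qed
  show "s \<in> ?R"
  proof
    show "s \<in> {a<..<b}" using s by (simp add: records_def)
    show "s \<notin> (\<Union>q\<in>\<rat> \<inter> {a..b}. {s \<in> {a<..<q}. run_min f s b = run_min f q b})"
    proof
      assume "s \<in> (\<Union>q\<in>\<rat> \<inter> {a..b}. {s \<in> {a<..<q}. run_min f s b = run_min f q b})"
      then obtain q where "q \<in> {a..b}" "s \<in> {a<..<q}" "run_min f s b = run_min f q b" by blast
      then show False using ne[of q] by simp
    qed
  qed
next
  fix s assume s: "s \<in> ?R"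
  then have sab: "a < s" "s < b" by simp_all
  have notflat: "run_min f s b \<noteq> run_min f q b" if q: "q \<in> \<rat>" "s < q" "q \<le> b" for q
  proof
    assume "run_min f s b = run_min f q b"
    then have "s \<in> {s \<in> {a<..<q}. run_min f s b = run_min f q b}" using q sab by simp
    moreover have "q \<in> \<rat> \<inter> {a..b}" using q sab by simp
    ultimately show False using s by blast
  qed
  have "f s < f t" if t: "t \<in> {s<..b}" for t
  proof (rule ccontr)
    assume nless: "\<not> f s < f t"
    obtain r where r: "r \<in> {s..b}" "run_min f s b = f r" "\<And>x. x \<in> {s..b} \<Longrightarrow> f r \<le> f x"
      using run_min_attained[OF less_imp_le[OF sab(2)]] by metis
    \<comment> \<open>A minimum point strictly after \<open>s\<close> is needed. If the chosen one
      is \<open>s\<close> itself, then \<open>t\<close> is another, because \<open>f t\<close> does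
      not exceed \<open>f s\<close>.\<close>
    define r' where "r' = (if r = s then t else r)"
    have r': "s < r'" "r' \<le> b" "run_min f s b = f r'"
      using r(1,2) t nless r(3)[of t] by (cases "r = s"; simp add: r'_def)+
    obtain q where q: "q \<in> \<rat>" "s < q" "q < r'" using Rats_dense_in_real[OF r'(1)] by blast
    have "run_min f q b \<le> run_min f s b"
      using r' q run_min_le[of r' q b] by simp
    moreover have "run_min f s b \<le> run_min f q b"
      using q r' by (intro run_min_mono_left) auto
    ultimately show False using notflat[of q] q r' by simp
  qed
  then show "s \<in> records f a b" using sab by (simp add: records_def)
qed

end

locale measure_pair = mu: diffuse_radon \<mu> + nu: diffuse_radon \<nu> for \<mu> \<nu> +
  assumes orth: "\<exists>C\<in>sets borel. emeasure \<mu> C = 0 \<and> emeasure \<nu> (- C) = 0"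
begin

lemma swap: "measure_pair \<nu> \<mu>"
proof unfold_locales
  obtain C where "C \<in> sets borel" "emeasure \<mu> C = 0" "emeasure \<nu> (- C) = 0" using orth by blast
  then show "\<exists>C\<in>sets borel. emeasure \<nu> C = 0 \<and> emeasure \<mu> (- C) = 0"
    by (intro bexI[of _ "-C"]) auto
qed

lemma cont_fun_net: "cont_fun (net \<mu> \<nu>)"
  unfolding net_def by unfold_locales (intro isCont_diff mu.isCont_cumul nu.isCont_cumul)

sublocale net: cont_fun "net \<mu> \<nu>" by (rule cont_fun_net)

text \<open>The Stieltjes measure of this function is carried by the records and agrees there with \<open>\<mu>\<close>.\<close>

definition clipped_min :: "real \<Rightarrow> real \<Rightarrow> real \<Rightarrow> real" where
  "clipped_min a b s = run_min (net \<mu> \<nu>) (max a (min s b)) b"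

text \<open>If the minimum over \<open>{s..b}\<close> is attained after \<open>t\<close>, the two
  minima agree. If it is attained at some \<open>r\<close> before \<open>t\<close>, the minimum over
  \<open>{t..b}\<close> exceeds it by at most the rise of the path from \<open>r\<close> to
  \<open>t\<close>, and only \<open>\<mu>\<close> makes the path rise.\<close>

lemma run_min_increment:
  assumes "s \<le> t" "t \<le> b"
  shows "run_min (net \<mu> \<nu>) t b - run_min (net \<mu> \<nu>) s b \<le> cumul \<mu> t - cumul \<mu> s"
proof (cases "run_min (net \<mu> \<nu>) s t \<le> run_min (net \<mu> \<nu>) t b")
  case False
  then show ?thesis using net.run_min_split[OF assms] mu.cumul_mono[OF assms(1)] by simp
next
  case True
  obtain r where r: "r \<in> {s..t}" "run_min (net \<mu> \<nu>) s t = net \<mu> \<nu> r"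
    using net.run_min_attained[OF assms(1)] by metis
  have "run_min (net \<mu> \<nu>) s b = net \<mu> \<nu> r"
    using net.run_min_split[OF assms] True r by simp
  moreover have "run_min (net \<mu> \<nu>) t b \<le> net \<mu> \<nu> t"
    using assms by (intro net.run_min_le) auto
  moreover have "net \<mu> \<nu> t - net \<mu> \<nu> r \<le> cumul \<mu> t - cumul \<mu> s"
    using r(1) mu.cumul_mono[of s r] nu.cumul_mono[of r t] by (simp add: net_def)
  ultimately show ?thesis by linarith
qed

lemma clipped_min_mono: "a \<le> b \<Longrightarrow> s \<le> t \<Longrightarrow> clipped_min a b s \<le> clipped_min a b t"
  unfolding clipped_min_def by (intro net.run_min_mono_left) (auto simp: max_def min_def)

text \<open>The increments are dominated by those of the continuous function
  \<open>cumul \<mu>\<close> at the clamped arguments.\<close>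

lemma clipped_min_cont: 
  assumes "a \<le> b"
  shows "continuous_on UNIV (clipped_min a b)"
proof (intro continuous_at_imp_continuous_on ballI)
  fix x
  let ?c = "\<lambda>s. max a (min s b)"
  let ?g = "\<lambda>s. cumul \<mu> (?c s)"
  have bound: "\<bar>clipped_min a b y - clipped_min a b x\<bar> \<le> \<bar>?g y - ?g x\<bar>" for y
    using run_min_increment[of "?c x" "?c y" b] run_min_increment[of "?c y" "?c x" b]
      clipped_min_mono[OF assms, of x y] clipped_min_mono[OF assms, of y x] assms
      mu.cumul_mono[of "?c x" "?c y"] mu.cumul_mono[of "?c y" "?c x"]
    unfolding clipped_min_def[symmetric]
    by (cases "x \<le> y") (auto simp: abs_le_iff clipped_min_def)
  have "isCont ?c x" by (intro continuous_intros)
  then have "isCont ?g x"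
    by (rule isCont_o2[OF _ mu.isCont_cumul])
  then have "((\<lambda>y. ?g y - ?g x) \<longlongrightarrow> 0) (at x)"
    unfolding isCont_def by (rule LIM_zero)
  then have "((\<lambda>y. \<bar>?g y - ?g x\<bar>) \<longlongrightarrow> 0) (at x)"
    by (rule tendsto_rabs_zero)
  then have "((\<lambda>y. clipped_min a b y - clipped_min a b x) \<longlongrightarrow> 0) (at x)"
    by (rule Lim_null_comparison[rotated]) (auto intro!: always_eventually bound)
  then show "isCont (clipped_min a b) x"
    unfolding isCont_def by (rule LIM_zero_cancel)
qed

lemma clipped_min_radon: 
  assumes "a \<le> b"
  shows "diffuse_radon (interval_measure (clipped_min a b))"
proof
  let ?K = "interval_measure (clipped_min a b)"
  have Icc: "emeasure ?K {s..t} = ennreal (clipped_min a b t - clipped_min a b s)" if "s \<le> t" for s t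
    using clipped_min_mono[OF assms] clipped_min_cont[OF assms] that
    by (intro emeasure_interval_measure_Icc)
  show "sets ?K = sets borel" by simp
  show "emeasure ?K {s..t} < \<infinity>" for s t by (cases "s \<le> t") (auto simp: Icc)
  show "emeasure ?K {s} = 0" for s using Icc[of s s] by simp
qed

lemma emeasure_clipped_min:
  assumes "a \<le> s" "s \<le> t" "t \<le> b"
  shows "emeasure (interval_measure (clipped_min a b)) {s..t} =
    ennreal (run_min (net \<mu> \<nu>) t b - run_min (net \<mu> \<nu>) s b)"
proof -
  have "a \<le> b" using assms by simp
  then have "emeasure (interval_measure (clipped_min a b)) {s..t} =
      ennreal (clipped_min a b t - clipped_min a b s)"
    using clipped_min_mono clipped_min_cont assms
    by (intro emeasure_interval_measure_Icc) auto
  then show ?thesis using assms by (simp add: clipped_min_def max_def min_def)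
qed

lemma flat_sets: "a \<le> b \<Longrightarrow> q \<in> {a..b} \<Longrightarrow>
    {s \<in> {a<..<q}. run_min (net \<mu> \<nu>) s b = run_min (net \<mu> \<nu>) q b} \<in> sets borel"
proof -
  assume ab: "a \<le> b" "q \<in> {a..b}"
  have [measurable]: "clipped_min a b \<in> borel_measurable borel"
    using clipped_min_cont[OF ab(1)] by (rule borel_measurable_continuous_onI)
  have "{s \<in> space borel. a < s \<and> s < q \<and> clipped_min a b s = clipped_min a b q} \<in> sets borel"
    by measurable
  also have "{s \<in> space borel. a < s \<and> s < q \<and> clipped_min a b s = clipped_min a b q} =
      {s \<in> {a<..<q}. run_min (net \<mu> \<nu>) s b = run_min (net \<mu> \<nu>) q b}"
    using ab by (auto simp: clipped_min_def max_def min_def)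
  finally show ?thesis .
qed

lemma records_sets [measurable]: "records (net \<mu> \<nu>) a b \<in> sets borel"
proof (cases "a \<le> b")
  case True
  then show ?thesis unfolding net.records_eq
    by (intro sets.Diff sets.countable_UN'' flat_sets) (auto intro: countable_rat countable_Int1)
next
  case False
  then have "records (net \<mu> \<nu>) a b = {}" by (auto simp: records_def)
  then show ?thesis by simp
qed

lemma records_subset: "records (net \<mu> \<nu>) a b \<subseteq> {a..b}"
  by (auto simp: records_def)

text \<open>Fills a right-hand slot of \<open>emeasure_le_if_hulls_le\<close> when fewer than two
  measures are to be compared with.\<close>

lemma null_radon: "diffuse_radon (null_measure borel)"
  by unfold_locales auto

text \<open>The path increases along the records, so \<open>\<nu>\<close> is at most
  \<open>\<mu>\<close> on intervals between records and hence on Borel sets of records. Intersecting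
  with the \<open>\<mu>\<close>-null set that carries \<open>\<nu>\<close> leaves nothing.\<close>

lemma nu_records: "emeasure \<nu> (records (net \<mu> \<nu>) a b) = 0"
proof -
  let ?S = "records (net \<mu> \<nu>) a b"
  obtain C where C: "C \<in> sets borel" "emeasure \<mu> C = 0" "emeasure \<nu> (- C) = 0" using orth by blast
  have "emeasure \<nu> (?S \<inter> C) \<le> emeasure \<mu> (?S \<inter> C) + emeasure (null_measure borel) (?S \<inter> C)"
  proof (rule emeasure_le_if_hulls_le[OF nu.diffuse_radon_axioms mu.diffuse_radon_axioms null_radon])
    show "?S \<inter> C \<in> sets borel" using C by simp
    show "?S \<inter> C \<subseteq> {a..b}" using records_subset by blast
    fix s t assume st: "s \<in> ?S \<inter> C" "t \<in> ?S \<inter> C" "s \<le> t"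
    then show "emeasure \<nu> {s..t} \<le> emeasure \<mu> {s..t} + emeasure (null_measure borel) {s..t}"
      using net.records_mono[of s a b t]
      by (auto simp: mu.emeasure_Icc_cumul nu.emeasure_Icc_cumul net_def intro!: ennreal_leI)
  qed
  also have "\<dots> \<le> emeasure \<mu> C" using C emeasure_mono[of "?S \<inter> C" C \<mu>] by simp
  finally have 1: "emeasure \<nu> (?S \<inter> C) = 0" using C by simp
  have "emeasure \<nu> ?S \<le> emeasure \<nu> ((?S \<inter> C) \<union> - C)"
    using C by (intro emeasure_mono) auto
  also have "\<dots> \<le> emeasure \<nu> (?S \<inter> C) + emeasure \<nu> (- C)"
    using C by (intro emeasure_subadditive) auto
  finally show ?thesis using 1 C by simp
qed

text \<open>The Stieltjes measure \<open>?K\<close> of the running minimum has mass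
  \<open>net \<mu> \<nu> b - run_min (net \<mu> \<nu>) a b\<close> on \<open>{a..b}\<close> and sits
  on the records. There it is squeezed against \<open>\<mu>\<close>: it is at most
  \<open>\<mu>\<close> by \<open>run_min_increment\<close>, and \<open>\<mu>\<close> is at most
  \<open>?K\<close> plus \<open>\<nu>\<close>, where \<open>\<nu>\<close> vanishes.\<close>

lemma mu_records:
  assumes "a \<le> b"
  shows "emeasure \<mu> (records (net \<mu> \<nu>) a b) = ennreal (net \<mu> \<nu> b - run_min (net \<mu> \<nu>) a b)"
proof -
  let ?S = "records (net \<mu> \<nu>) a b"
  let ?K = "interval_measure (clipped_min a b)"
  let ?m = "\<lambda>s. run_min (net \<mu> \<nu>) s b"
  interpret K: diffuse_radon ?K by (rule clipped_min_radon[OF assms])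
  \<comment> \<open>Two points of a flat piece have the same running minimum, so \<open>?K\<close>
    gives no mass to the interval between them.\<close>
  have flat: "emeasure ?K {s \<in> {a<..<q}. ?m s = ?m q} = 0" if q: "q \<in> {a..b}" for q
  proof -
    let ?E = "{s \<in> {a<..<q}. ?m s = ?m q}"
    have "emeasure ?K ?E \<le> emeasure (null_measure borel) ?E + emeasure (null_measure borel) ?E"
    proof (rule emeasure_le_if_hulls_le[OF K.diffuse_radon_axioms null_radon null_radon])
      show "?E \<in> sets borel" by (rule flat_sets[OF assms q])
      show "?E \<subseteq> {a..b}" using q by auto
      show "emeasure ?K {s..t} \<le> emeasure (null_measure borel) {s..t} + emeasure (null_measure borel) {s..t}"
        if "s \<in> ?E" "t \<in> ?E" "s \<le> t" for s t
        using that q by (subst emeasure_clipped_min) auto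
    qed
    then show ?thesis by simp
  qed
  have "(\<Union>q\<in>\<rat> \<inter> {a..b}. {s \<in> {a<..<q}. ?m s = ?m q}) \<in> null_sets ?K"
    using flat_sets[OF assms] flat countable_rat
    by (intro null_sets_UN') (auto simp: null_sets_def countable_Int1)
  moreover have "{a<..<b} - ?S \<subseteq> (\<Union>q\<in>\<rat> \<inter> {a..b}. {s \<in> {a<..<q}. ?m s = ?m q})"
    unfolding net.records_eq by blast
  moreover have "{a<..<b} - ?S \<in> sets ?K" by simp
  ultimately have "{a<..<b} - ?S \<in> null_sets ?K"
    using null_sets_subset by blast
  then have KS: "emeasure ?K ({a<..<b} - ?S) = 0" by blast
  have Kab: "emeasure ?K {a..b} = ennreal (net \<mu> \<nu> b - ?m a)"
    using assms by (subst emeasure_clipped_min) auto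
  have "emeasure ?K {a..b} \<le> emeasure ?K (?S \<union> (({a<..<b} - ?S) \<union> ({a} \<union> {b})))"
    by (intro emeasure_mono) auto
  also have "\<dots> \<le> emeasure ?K ?S + (emeasure ?K ({a<..<b} - ?S) + (emeasure ?K {a} + emeasure ?K {b}))"
    by (intro order_trans[OF emeasure_subadditive] add_mono order_refl) auto
  finally have 1: "emeasure ?K {a..b} \<le> emeasure ?K ?S" using KS by simp
  have "emeasure ?K ?S \<le> emeasure \<mu> ?S + emeasure (null_measure borel) ?S"
  proof (rule emeasure_le_if_hulls_le[OF K.diffuse_radon_axioms mu.diffuse_radon_axioms null_radon _ records_subset])
    fix s t assume st: "s \<in> ?S" "t \<in> ?S" "s \<le> t"
    then have "a \<le> s" "t \<le> b" by (auto simp: records_def)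
    then show "emeasure ?K {s..t} \<le> emeasure \<mu> {s..t} + emeasure (null_measure borel) {s..t}"
      using st run_min_increment[of s t b]
      by (auto simp: emeasure_clipped_min mu.emeasure_Icc_cumul intro!: ennreal_leI)
  qed simp
  then have 2: "emeasure ?K ?S \<le> emeasure \<mu> ?S" by simp
  have "emeasure \<mu> ?S \<le> emeasure ?K ?S + emeasure \<nu> ?S"
  proof (rule emeasure_le_if_hulls_le[OF mu.diffuse_radon_axioms K.diffuse_radon_axioms nu.diffuse_radon_axioms _ records_subset])
    fix s t assume st: "s \<in> ?S" "t \<in> ?S" "s \<le> t"
    then have ab: "a \<le> s" "t \<le> b" by (auto simp: records_def)
    \<comment> \<open>At a record the running minimum equals the path itself, so the bound of
      \<open>run_min_increment\<close> is replaced by an identity with the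
      \<open>\<nu>\<close>-increment as correction.\<close>
    have "cumul \<mu> t - cumul \<mu> s = (?m t - ?m s) + (cumul \<nu> t - cumul \<nu> s)"
      using net.run_min_records[OF st(1)] net.run_min_records[OF st(2)] by (simp add: net_def)
    then show "emeasure \<mu> {s..t} \<le> emeasure ?K {s..t} + emeasure \<nu> {s..t}"
      using st ab nu.cumul_mono[of s t] net.run_min_mono_left[of s t b]
      by (simp add: emeasure_clipped_min mu.emeasure_Icc_cumul nu.emeasure_Icc_cumul flip: ennreal_plus)
  qed simp
  then have 3: "emeasure \<mu> ?S \<le> emeasure ?K ?S" by (simp add: nu_records)
  have "emeasure ?K ?S \<le> emeasure ?K {a..b}"
    by (intro emeasure_mono records_subset) simp
  with 1 2 3 Kab show ?thesis by (metis antisym)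
qed

end

subsection \<open>The matching\<close>

definition match_time :: "(real \<Rightarrow> real) \<Rightarrow> real \<Rightarrow> ereal" where
  "match_time f s = Inf (ereal ` {t. s < t \<and> f t = f s})"

lemma match_time_ge: "ereal s \<le> match_time f s"
  unfolding match_time_def by (intro Inf_greatest) auto

lemma match_time_less_iff: "match_time f s < c \<longleftrightarrow> (\<exists>t. s < t \<and> ereal t < c \<and> f t = f s)"
  unfolding match_time_def Inf_less_iff by auto

section \<open>Measurability for processes with continuous paths\<close>

locale cont_process =
  fixes \<Omega> :: "'a measure" and F :: "'a \<Rightarrow> real \<Rightarrow> real"
  assumes F_cont: "\<omega> \<in> space \<Omega> \<Longrightarrow> isCont (F \<omega>) t"
    and F_meas [measurable]: "(\<lambda>\<omega>. F \<omega> t) \<in> borel_measurable \<Omega>"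
begin

lemma F_fun: "\<omega> \<in> space \<Omega> \<Longrightarrow> cont_fun (F \<omega>)"
  by unfold_locales (rule F_cont)

lemma run_min_measurable [measurable]: "(\<lambda>\<omega>. run_min (F \<omega>) a b) \<in> borel_measurable \<Omega>"
proof (cases "a \<le> b")
  case False
  then show ?thesis by (simp add: run_min_def)
next
  case True
  \<comment> \<open>Clamped rationals are dense in \<open>{a..b}\<close> even if
    \<open>a = b\<close> is irrational, which rationals inside the interval would not be.\<close>
  have iff: "c \<le> run_min (F \<omega>) a b \<longleftrightarrow> (\<forall>q::rat. c \<le> F \<omega> (max a (min b (of_rat q))))"
    if w: "\<omega> \<in> space \<Omega>" for \<omega> c
  proof
    interpret cont_fun "F \<omega>" by (rule F_fun[OF w])
    show "\<forall>q::rat. c \<le> F \<omega> (max a (min b (of_rat q)))" if "c \<le> run_min (F \<omega>) a b"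
      using that True by (auto intro!: order_trans[OF that run_min_le])
    assume q: "\<forall>q::rat. c \<le> F \<omega> (max a (min b (of_rat q)))"
    have "continuous_on UNIV (\<lambda>x. F \<omega> (max a (min b x)))"
      by (rule continuous_on_compose2[OF cont_on]) (auto intro!: continuous_intros)
    then have "closed ((\<lambda>x. F \<omega> (max a (min b x))) -` {c..})"
      using continuous_closed_vimage by (simp add: continuous_on_closed_vimage)
    moreover have "\<rat> \<subseteq> (\<lambda>x. F \<omega> (max a (min b x))) -` {c..}"
      using q by (auto simp: Rats_def)
    moreover have "closure \<rat> = (UNIV :: real set)" by (rule Rats_closure_real)
    ultimately have "UNIV \<subseteq> (\<lambda>x. F \<omega> (max a (min b x))) -` {c..}"
      using closure_minimal by metis
    then have "c \<le> F \<omega> (max a (min b x))" for x by auto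
    then have "c \<le> F \<omega> x" if "x \<in> {a..b}" for x
      using that by (metis atLeastAtMost_iff max.absorb2 min.absorb2)
    then show "c \<le> run_min (F \<omega>) a b" using True by (intro le_run_min)
  qed
  show ?thesis
    unfolding borel_measurable_iff_ge
  proof
    fix c
    have "{w \<in> space \<Omega>. c \<le> run_min (F w) a b} =
        {w \<in> space \<Omega>. \<forall>q::rat. c \<le> F w (max a (min b (of_rat q)))}"
      using iff by blast
    also have "\<dots> \<in> sets \<Omega>" by measurable
    finally show "{w \<in> space \<Omega>. c \<le> run_min (F w) a b} \<in> sets \<Omega>" .
  qed
qed

text \<open>Rounding the time down to a multiple of \<open>1 / real (Suc n)\<close> leaves countably
  many fixed times, and continuity of the paths gives the limit.\<close>

lemma joint_measurable: "(\<lambda>(\<omega>, s). F \<omega> s) \<in> borel_measurable (\<Omega> \<Otimes>\<^sub>M borel)"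
proof (rule borel_measurable_LIMSEQ_real)
  let ?r = "\<lambda>n s. of_int \<lfloor>real (Suc n) * s\<rfloor> / real (Suc n)"
  fix n
  have "(\<lambda>x. (\<lambda>i x. F (fst x) (of_int i / real (Suc n))) \<lfloor>real (Suc n) * snd x\<rfloor> x)
      \<in> borel_measurable (\<Omega> \<Otimes>\<^sub>M (borel :: real measure))"
    by (rule measurable_compose_countable[where g = "\<lambda>x. \<lfloor>real (Suc n) * snd x\<rfloor>"])
      (auto intro!: measurable_compose[OF _ measurable_real_floor])
  then show "(\<lambda>x. F (fst x) (?r n (snd x))) \<in> borel_measurable (\<Omega> \<Otimes>\<^sub>M borel)"
    by simp
next
  let ?r = "\<lambda>n s. of_int \<lfloor>real (Suc n) * s\<rfloor> / real (Suc n)"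
  fix x :: "'a \<times> real" assume "x \<in> space (\<Omega> \<Otimes>\<^sub>M borel)"
  then have w: "fst x \<in> space \<Omega>" by (auto simp: space_pair_measure)
  have "(\<lambda>n. ?r n s) \<longlonglongrightarrow> s" for s
  proof (rule LIMSEQ_I)
    fix e :: real assume "e > 0"
    then obtain N where N: "inverse (real (Suc N)) < e" using reals_Archimedean by blast
    have "\<bar>?r n s - s\<bar> < e" if "n \<ge> N" for n
    proof -
      have k: "real (Suc n) > 0" by simp
      have "?r n s \<le> s" using of_int_floor_le[of "real (Suc n) * s"] k by (simp add: divide_le_eq mult.commute)
      moreover have "s - 1 / real (Suc n) < ?r n s"
      proof -
        have "real (Suc n) * s - 1 < of_int \<lfloor>real (Suc n) * s\<rfloor>" by linarith
        then have "(real (Suc n) * s - 1) / real (Suc n) < of_int \<lfloor>real (Suc n) * s\<rfloor> / real (Suc n)"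
          by (rule divide_strict_right_mono) (rule k)
        then show ?thesis by (simp only: diff_divide_distrib) simp
      qed
      moreover have "1 / real (Suc n) \<le> inverse (real (Suc N))"
        using that by (simp add: inverse_eq_divide frac_le)
      ultimately show ?thesis using N by linarith
    qed
    then show "\<exists>N. \<forall>n\<ge>N. norm (?r n s - s) < e" by auto
  qed
  then show "(\<lambda>n. F (fst x) (?r n (snd x))) \<longlonglongrightarrow> (case x of (\<omega>, s) \<Rightarrow> F \<omega> s)"
    unfolding split_beta by (intro isCont_tendsto_compose[OF F_cont[OF w]])
qed

lemma uminus_process: "cont_process \<Omega> (\<lambda>\<omega> t. - F \<omega> t)"
  by unfold_locales (auto intro: isCont_minus F_cont)

text \<open>By the intermediate value theorem, the path returns to its level at \<open>s\<close>
  before \<open>c\<close> exactly if, on some rational interval after \<open>s\<close> and before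
  \<open>c\<close>, its minimum is at most and its maximum at least that level. The maximum is
  written as minus the running minimum of the negated path.\<close>

lemma match_time_measurable: "(\<lambda>(\<omega>, s). match_time (F \<omega>) s) \<in> borel_measurable (\<Omega> \<Otimes>\<^sub>M borel)"
proof -
  note uminus = cont_process.run_min_measurable[OF uminus_process]
  have real: "match_time (F \<omega>) s < c \<longleftrightarrow>
      (\<exists>q r::rat. s < of_rat q \<and> (of_rat q :: real) \<le> of_rat r \<and> ereal (of_rat r) < c \<and>
        run_min (F \<omega>) (of_rat q) (of_rat r) \<le> F \<omega> s \<and> F \<omega> s \<le> - run_min (\<lambda>t. - F \<omega> t) (of_rat q) (of_rat r))"
    if w: "\<omega> \<in> space \<Omega>" for \<omega> s c
  proof -
    interpret cont_fun "F \<omega>" by (rule F_fun[OF w])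
    interpret m: cont_fun "\<lambda>t. - F \<omega> t" by (rule cont_process.F_fun[OF uminus_process w])
    show ?thesis unfolding match_time_less_iff
    proof safe
      fix t assume t: "s < t" "ereal t < c" "F \<omega> t = F \<omega> s"
      obtain q where q: "s < of_rat q" "of_rat q < t" using of_rat_dense[OF t(1)] by blast
      obtain r :: rat where r: "t < of_rat r" "ereal (of_rat r) < c"
        using ereal_dense3[OF t(2)] by auto
      show "\<exists>q r::rat. s < of_rat q \<and> (of_rat q :: real) \<le> of_rat r \<and> ereal (of_rat r) < c \<and>
        run_min (F \<omega>) (of_rat q) (of_rat r) \<le> F \<omega> s \<and> F \<omega> s \<le> - run_min (\<lambda>t. - F \<omega> t) (of_rat q) (of_rat r)"
        using q r run_min_le[of t "of_rat q" "of_rat r"] m.run_min_le[of t "of_rat q" "of_rat r"] t(3)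
        by (intro exI[of _ q] exI[of _ r]) auto
    next
      fix q r :: rat
      assume qr: "s < of_rat q" "(of_rat q :: real) \<le> of_rat r" "ereal (of_rat r) < c"
        and 1: "run_min (F \<omega>) (of_rat q) (of_rat r) \<le> F \<omega> s"
        and 2: "F \<omega> s \<le> - run_min (\<lambda>t. - F \<omega> t) (of_rat q) (of_rat r)"
      obtain x where x: "x \<in> {of_rat q..of_rat r}" "F \<omega> x \<le> F \<omega> s"
        using run_min_attained[OF qr(2)] 1 by metis
      obtain y where y: "y \<in> {of_rat q..of_rat r}" "F \<omega> s \<le> F \<omega> y"
        using m.run_min_attained[OF qr(2)] 2 by (metis minus_le_iff minus_minus)
      have "connected (F \<omega> ` {of_rat q..of_rat r})"
        by (intro connected_continuous_image cont_on connected_Icc)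
      then have "F \<omega> s \<in> F \<omega> ` {of_rat q..of_rat r}"
        using x y unfolding connected_iff_interval by blast
      then obtain t where t: "t \<in> {of_rat q..of_rat r}" "F \<omega> s = F \<omega> t" by blast
      then have "ereal t < c" using qr(3) by (meson atLeastAtMost_iff ereal_less_eq(3) le_less_trans)
      then show "\<exists>t>s. ereal t < c \<and> F \<omega> t = F \<omega> s" using t qr(1) by (intro exI[of _ t]) auto
    qed
  qed
  have G [measurable]: "(\<lambda>x. F (fst x) (snd x)) \<in> borel_measurable (\<Omega> \<Otimes>\<^sub>M borel)"
    using joint_measurable by (simp add: split_beta')
  have m1 [measurable]: "(\<lambda>x. run_min (F (fst x)) a b) \<in> borel_measurable (\<Omega> \<Otimes>\<^sub>M (borel :: real measure))" for a b
    by (rule measurable_compose[OF measurable_fst run_min_measurable])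
  have m2 [measurable]: "(\<lambda>x. run_min (\<lambda>t. - F (fst x) t) a b) \<in> borel_measurable (\<Omega> \<Otimes>\<^sub>M (borel :: real measure))" for a b
    by (rule measurable_compose[OF measurable_fst uminus])
  show ?thesis
    unfolding borel_measurable_ereal_iff_Iio
  proof
    fix c
    define Q where "Q = (\<lambda>q r (x :: 'a \<times> real). snd x < of_rat q \<and> (of_rat q :: real) \<le> of_rat r \<and>
      ereal (of_rat r) < c \<and> run_min (F (fst x)) (of_rat q) (of_rat r) \<le> F (fst x) (snd x) \<and>
      F (fst x) (snd x) \<le> - run_min (\<lambda>t. - F (fst x) t) (of_rat q) (of_rat r))"
    have [measurable]: "Measurable.pred (\<Omega> \<Otimes>\<^sub>M borel) (Q q r)" for q r
      unfolding Q_def by measurable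
    have "match_time (F (fst x)) (snd x) < c \<longleftrightarrow> (\<exists>q r. Q q r x)"
      if "x \<in> space (\<Omega> \<Otimes>\<^sub>M borel)" for x
      unfolding Q_def by (rule real) (use that in \<open>simp add: space_pair_measure mem_Times_iff\<close>)
    then have "{x \<in> space (\<Omega> \<Otimes>\<^sub>M borel). match_time (F (fst x)) (snd x) < c} =
        {x \<in> space (\<Omega> \<Otimes>\<^sub>M borel). \<exists>q r. Q q r x}"
      by (rule Collect_cong[OF conj_cong[OF refl]])
    moreover have "(\<lambda>(\<omega>, s). match_time (F \<omega>) s) -` {..<c} \<inter> space (\<Omega> \<Otimes>\<^sub>M borel) =
        {x \<in> space (\<Omega> \<Otimes>\<^sub>M borel). match_time (F (fst x)) (snd x) < c}"
      by auto
    moreover have "{x \<in> space (\<Omega> \<Otimes>\<^sub>M borel). \<exists>q r. Q q r x} \<in> sets (\<Omega> \<Otimes>\<^sub>M borel)"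
      by measurable
    ultimately show "(\<lambda>(\<omega>, s). match_time (F \<omega>) s) -` {..<c} \<inter> space (\<Omega> \<Otimes>\<^sub>M borel) \<in> sets (\<Omega> \<Otimes>\<^sub>M borel)"
      by simp
  qed
qed

end

context cont_fun
begin

lemma match_time_section: "match_time f \<in> borel_measurable borel"
proof -
  \<comment> \<open>A single path is a process over a one-point space.\<close>
  interpret cont_process "count_space {()}" "\<lambda>_. f" by unfold_locales (auto intro: cont)
  show ?thesis using measurable_Pair2[OF match_time_measurable, of "()"] by simp
qed

lemma match_time_gt_iff:
  assumes "s < b"
  shows "ereal b < match_time f s \<longleftrightarrow> (\<forall>t\<in>{s<..b}. f t \<noteq> f s)"
proof
  assume "ereal b < match_time f s"
  moreover have "match_time f s \<le> ereal t" if "s < t" "f t = f s" for t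
    unfolding match_time_def using that by (intro Inf_lower) auto
  ultimately show "\<forall>t\<in>{s<..b}. f t \<noteq> f s"
    by (metis greaterThanAtMost_iff ereal_less_eq(3) leD order_trans)
next
  assume ne: "\<forall>t\<in>{s<..b}. f t \<noteq> f s"
  \<comment> \<open>Without returns up to \<open>b\<close> the infimum is at least \<open>b\<close>.
    Since \<open>f b\<close> differs from \<open>f s\<close>, continuity excludes returns shortly
    after \<open>b\<close> as well, which makes the inequality strict.\<close>
  have "\<forall>\<^sub>F t in at b. f t \<noteq> f s"
    using ne assms cont[of b] unfolding isCont_def by (intro tendsto_imp_eventually_ne) auto
  then obtain d where d: "d > 0" "\<And>t. t \<noteq> b \<Longrightarrow> dist t b < d \<Longrightarrow> f t \<noteq> f s"
    unfolding eventually_at by auto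
  have "ereal (b + d) \<le> match_time f s"
    unfolding match_time_def
  proof (intro Inf_greatest, clarify)
    fix t assume t: "s < t" "f t = f s"
    then have "t > b" using ne by force
    then show "ereal (b + d) \<le> ereal t"
      using d(2)[of t] t by (cases "t - b < d") (auto simp: dist_real_def)
  qed
  moreover have "ereal b < ereal (b + d)" using d(1) by simp
  ultimately show "ereal b < match_time f s" by (rule less_le_trans[rotated])
qed

text \<open>A path that avoids its level at \<open>s\<close> throughout \<open>{s<..b}\<close> stays
  strictly above or strictly below it, by the intermediate value theorem.\<close>

lemma unmatched_eq_records:
  "{s \<in> {a<..<b}. ereal b < match_time f s} = records f a b \<union> records (\<lambda>t. - f t) a b"
proof (intro equalityI subsetI)
  fix s assume "s \<in> {s \<in> {a<..<b}. ereal b < match_time f s}"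
  then have s: "a < s" "s < b" and ne: "\<And>t. t \<in> {s<..b} \<Longrightarrow> f t \<noteq> f s"
    using match_time_gt_iff by auto
  have False if tu: "t \<in> {s<..b}" "u \<in> {s<..b}" "f t < f s" "f s < f u" for t u
  proof -
    have "connected (f ` {s<..b})"
      by (intro connected_continuous_image cont_on connected_Ioc)
    then have "f s \<in> f ` {s<..b}"
      using tu unfolding connected_iff_interval by (meson imageI less_imp_le)
    then show False using ne by force
  qed
  then have "(\<forall>t\<in>{s<..b}. f s < f t) \<or> (\<forall>t\<in>{s<..b}. f t < f s)"
    using ne by (metis linorder_neqE_linordered_idom)
  then show "s \<in> records f a b \<union> records (\<lambda>t. - f t) a b"
    using s by (auto simp: records_def)
next
  fix s assume "s \<in> records f a b \<union> records (\<lambda>t. - f t) a b"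
  then have "a < s" "s < b" "\<forall>t\<in>{s<..b}. f t \<noteq> f s"
    by (auto simp: records_def)
  then show "s \<in> {s \<in> {a<..<b}. ereal b < match_time f s}"
    using match_time_gt_iff by auto
qed

end

context measure_pair
begin

lemma match_time_measurable [measurable]: "match_time (net \<mu> \<nu>) \<in> borel_measurable borel"
  by (rule net.match_time_section)

lemma emeasure_unmatched:
  assumes "a \<le> b"
  shows "emeasure \<mu> {s \<in> {a<..<b}. ereal b < match_time (net \<mu> \<nu>) s} =
    ennreal (net \<mu> \<nu> b - run_min (net \<mu> \<nu>) a b)"
proof -
  interpret sw: measure_pair \<nu> \<mu> by (rule swap)
  have neg: "(\<lambda>t. - net \<mu> \<nu> t) = net \<nu> \<mu>" by (auto simp: net_def)
  \<comment> \<open>The records of the negated path belong to the swapped pair, so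
    \<open>nu_records\<close> makes them null for \<open>\<mu>\<close>. Only the records from above
    level \<open>f s\<close> contribute mass.\<close>
  have "records (net \<nu> \<mu>) a b \<in> null_sets \<mu>"
    using sw.nu_records[of a b] sw.records_sets[of a b] by (auto simp: null_sets_def)
  then show ?thesis
    unfolding net.unmatched_eq_records neg mu_records[OF assms, symmetric]
    by (intro emeasure_Un_null_set) auto
qed

end

section \<open>Transport of one measure to the other along a single path\<close>

context measure_pair
begin

abbreviation "f \<equiv> net \<mu> \<nu>"

text \<open>The expression in \<open>lim\<close> is the mass of the points between
  \<open>- real k\<close> and \<open>real k\<close> that are still unmatched at time
  \<open>real n\<close>. It bounds the mass of the points that are never matched.\<close>

lemma match_time_finite_AE:
  assumes lim: "\<And>k::nat. (\<lambda>n. run_min f (real k) (real n) - run_min f (- real k) (real n)) \<longlonglongrightarrow> 0"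
  shows "AE s in \<mu>. \<bar>match_time f s\<bar> \<noteq> \<infinity>"
proof -
  let ?U = "\<lambda>a b. {s \<in> {a<..<b}. ereal b < match_time f s}"
  have "{s \<in> {- real k<..<real k}. match_time f s = \<infinity>} \<in> null_sets \<mu>" (is "?N \<in> _") for k
  proof -
    have le: "emeasure \<mu> ?N \<le> ennreal (run_min f (real k) (real n) - run_min f (- real k) (real n))"
      if n: "k \<le> n" for n
    proof -
      have unm: "emeasure \<mu> (?U (real k) (real n)) = ennreal (f (real n) - run_min f (real k) (real n))"
        "emeasure \<mu> (?U (- real k) (real n)) = ennreal (f (real n) - run_min f (- real k) (real n))"
        using n by (intro emeasure_unmatched; simp)+
      \<comment> \<open>The two sets on the left are disjoint, so subtracting the masses given by
        \<open>emeasure_unmatched\<close> isolates \<open>?N\<close>.\<close>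
      have "?N \<union> ?U (real k) (real n) \<subseteq> ?U (- real k) (real n)"
        using n by auto
      then have "emeasure \<mu> (?N \<union> ?U (real k) (real n)) \<le> emeasure \<mu> (?U (- real k) (real n))"
        by (intro emeasure_mono) auto
      moreover have "emeasure \<mu> (?N \<union> ?U (real k) (real n)) = emeasure \<mu> ?N + emeasure \<mu> (?U (real k) (real n))"
        by (rule plus_emeasure[symmetric]) auto
      moreover have "f (real n) - run_min f (real k) (real n) \<ge> 0"
        using net.run_min_le[of "real n" "real k" "real n"] n by simp
      ultimately have "emeasure \<mu> ?N + ennreal (f (real n) - run_min f (real k) (real n))
          \<le> ennreal (f (real n) - run_min f (- real k) (real n))"
        by (simp only: unm)
      also have "\<dots> = ennreal (run_min f (real k) (real n) - run_min f (- real k) (real n))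
          + ennreal (f (real n) - run_min f (real k) (real n))"
        using n net.run_min_mono_left[of "- real k" "real k" "real n"]
          \<open>f (real n) - run_min f (real k) (real n) \<ge> 0\<close>
        by (subst ennreal_plus[symmetric]) auto
      finally show ?thesis
        unfolding add.commute[of _ "ennreal (f (real n) - run_min f (real k) (real n))"]
          ennreal_add_left_cancel_le by simp
    qed
    have "(\<lambda>n. ennreal (run_min f (real k) (real n) - run_min f (- real k) (real n))) \<longlonglongrightarrow> ennreal 0"
      by (intro tendsto_ennrealI lim)
    then have "emeasure \<mu> ?N \<le> ennreal 0"
      by (rule LIMSEQ_le_const) (use le in blast)
    then show ?thesis by (auto simp: null_sets_def)
  qed
  then have "(\<Union>k. {s \<in> {- real k<..<real k}. match_time f s = \<infinity>}) \<in> null_sets \<mu>"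
    by (intro null_sets_UN) auto
  then have "AE s in \<mu>. s \<notin> (\<Union>k. {s \<in> {- real k<..<real k}. match_time f s = \<infinity>})"
    by (rule AE_not_in)
  then show ?thesis
  proof eventually_elim
    case (elim s)
    obtain k where "\<bar>s\<bar> < real k" using reals_Archimedean2 by blast
    then have "s \<in> {- real k<..<real k}" by auto
    then have "match_time f s \<noteq> \<infinity>" using elim by blast
    moreover have "match_time f s \<noteq> -\<infinity>" using match_time_ge[of s f] by auto
    ultimately show ?case by auto
  qed
qed

text \<open>Counts the points after \<open>- real n\<close> matched by time \<open>b'\<close> and
  removes those before \<open>b\<close> matched by time \<open>b\<close>. The unknown start at
  \<open>- real n\<close> cancels, and what remains is the \<open>\<nu>\<close>-mass of
  \<open>{b..b'}\<close> less the expression in \<open>lim\<close>.\<close>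

lemma emeasure_match_time_Ioc:
  assumes "b \<le> b'"
    and lim: "(\<lambda>n. run_min f (- real n) b - run_min f (- real n) b') \<longlonglongrightarrow> 0"
  shows "emeasure \<mu> {s. match_time f s \<in> {ereal b<..ereal b'}} = emeasure \<nu> {b..b'}"
proof -
  let ?M = "match_time f"
  let ?D = "\<lambda>n. {s \<in> {- real n<..<b'}. ?M s \<in> {ereal b<..ereal b'}}"
  \<comment> \<open>The full mass of the interval less the unmatched mass
    \<open>f c - run_min f a c\<close>.\<close>
  have matched: "emeasure \<mu> {s \<in> {a<..<c}. ?M s \<le> ereal c} =
      ennreal (cumul \<nu> c - cumul \<mu> a + run_min f a c)" if ac: "a \<le> c" for a c
  proof -
    have Icc: "emeasure \<mu> {a<..<c} = ennreal (cumul \<mu> c - cumul \<mu> a)"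
    proof -
      have "{a..c} = {a<..<c} \<union> {a, c}" using ac by auto
      moreover have "{a, c} \<in> null_sets \<mu>"
        using emeasure_subadditive[of "{a}" \<mu> "{c}"] by (auto simp: null_sets_def insert_commute)
      then have "emeasure \<mu> ({a<..<c} \<union> {a, c}) = emeasure \<mu> {a<..<c}"
        by (intro emeasure_Un_null_set) auto
      ultimately have "emeasure \<mu> {a..c} = emeasure \<mu> {a<..<c}"
        by (simp only:)
      then show ?thesis using mu.emeasure_Icc_cumul[OF ac] by simp
    qed
    have eq: "{s \<in> {a<..<c}. ?M s \<le> ereal c} = {a<..<c} - {s \<in> {a<..<c}. ereal c < ?M s}"
      by auto
    have "emeasure \<mu> {s \<in> {a<..<c}. ?M s \<le> ereal c} =
        emeasure \<mu> {a<..<c} - emeasure \<mu> {s \<in> {a<..<c}. ereal c < ?M s}"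
      unfolding eq
    proof (rule emeasure_Diff)
      show "emeasure \<mu> {s \<in> {a<..<c}. ereal c < ?M s} \<noteq> \<infinity>"
        unfolding emeasure_unmatched[OF ac] by simp
      show "{s \<in> {a<..<c}. ereal c < ?M s} \<in> sets \<mu>" by simp
      show "{s \<in> {a<..<c}. ereal c < ?M s} \<subseteq> {a<..<c}" by blast
    qed simp
    also have "\<dots> = ennreal ((cumul \<mu> c - cumul \<mu> a) - (f c - run_min f a c))"
      unfolding Icc emeasure_unmatched[OF ac]
      using net.run_min_le[of c a c] ac by (intro ennreal_minus) auto
    finally show ?thesis by (simp add: net_def algebra_simps)
  qed
  have D: "emeasure \<mu> (?D n) =
      ennreal (cumul \<nu> b' - cumul \<nu> b - (run_min f (- real n) b - run_min f (- real n) b'))"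
    if n: "- real n \<le> b" for n
  proof -
    let ?A = "{s \<in> {- real n<..<b'}. ?M s \<le> ereal b'}"
    let ?B = "{s \<in> {- real n<..<b}. ?M s \<le> ereal b}"
    have le: "?M s \<ge> ereal s" for s by (rule match_time_ge)
    have sub: "?B \<subseteq> ?A" using assms(1) by (auto intro: order_trans)
    \<comment> \<open>For \<open>s = b\<close> the bound \<open>match_time_ge\<close> gives only a
      weak inequality, so this null point is added.\<close>
    have 1: "?A - ?B \<subseteq> ?D n \<union> {b}"
    proof
      fix s assume s: "s \<in> ?A - ?B"
      show "s \<in> ?D n \<union> {b}"
      proof (cases "s < b")
        case False
        then have "s = b \<or> b < s" by linarith
        then have "s = b \<or> ereal b < ?M s" using less_le_trans[OF _ le[of s], of "ereal b"] by auto
        then show ?thesis using s by auto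
      qed (use s in auto)
    qed
    have 2: "?D n \<subseteq> ?A - ?B" by auto
    have "emeasure \<mu> (?D n) = emeasure \<mu> (?A - ?B)"
    proof (rule antisym)
      show "emeasure \<mu> (?D n) \<le> emeasure \<mu> (?A - ?B)" by (intro emeasure_mono 2) auto
      have "emeasure \<mu> (?A - ?B) \<le> emeasure \<mu> (?D n \<union> {b})" by (intro emeasure_mono 1) auto
      also have "\<dots> = emeasure \<mu> (?D n)" by (rule emeasure_Un_null_set) (auto simp: null_sets_def)
      finally show "emeasure \<mu> (?A - ?B) \<le> emeasure \<mu> (?D n)" .
    qed
    also have "\<dots> = emeasure \<mu> ?A - emeasure \<mu> ?B"
    proof (rule emeasure_Diff[OF _ _ _ sub])
      show "emeasure \<mu> ?B \<noteq> \<infinity>" unfolding matched[OF n] by simp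
    qed simp_all
    also have "\<dots> = ennreal (cumul \<nu> b' - cumul \<mu> (- real n) + run_min f (- real n) b')
        - ennreal (cumul \<nu> b - cumul \<mu> (- real n) + run_min f (- real n) b)"
      using matched[OF n] matched[of "- real n" b'] n assms(1) by simp
    also have "\<dots> = ennreal ((cumul \<nu> b' - cumul \<mu> (- real n) + run_min f (- real n) b')
        - (cumul \<nu> b - cumul \<mu> (- real n) + run_min f (- real n) b))"
    proof (rule ennreal_minus)
      \<comment> \<open>With the minimum at \<open>r\<close>, the subtrahend is the
        \<open>\<mu>\<close>-increment up to \<open>r\<close> plus the
        \<open>\<nu>\<close>-increment after \<open>r\<close>, hence nonnegative.\<close>
      obtain r where r: "r \<in> {- real n..b}" "run_min f (- real n) b = f r"
        using net.run_min_attained[OF n] by metis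
      then show "0 \<le> cumul \<nu> b - cumul \<mu> (- real n) + run_min f (- real n) b"
        using mu.cumul_mono[of "- real n" r] nu.cumul_mono[of r b] by (simp add: net_def)
    qed
    finally show ?thesis by (simp add: algebra_simps)
  qed
  have "(\<lambda>n. emeasure \<mu> (?D n)) \<longlonglongrightarrow> emeasure \<mu> (\<Union>n. ?D n)"
    by (intro Lim_emeasure_incseq) (auto simp: incseq_def)
  moreover have "(\<lambda>n. emeasure \<mu> (?D n)) \<longlonglongrightarrow> ennreal (cumul \<nu> b' - cumul \<nu> b - 0)"
  proof (rule Lim_transform_eventually)
    show "(\<lambda>n. ennreal (cumul \<nu> b' - cumul \<nu> b - (run_min f (- real n) b - run_min f (- real n) b')))
        \<longlonglongrightarrow> ennreal (cumul \<nu> b' - cumul \<nu> b - 0)"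
      by (intro tendsto_ennrealI tendsto_diff tendsto_const lim)
    obtain N where "- b \<le> real N" using real_arch_simple by blast
    then have "- real n \<le> b" if "n \<ge> N" for n
      using of_nat_mono[OF that, where ?'a = real] by linarith
    then have "\<forall>n\<ge>N. - real n \<le> b" by blast
    then show "\<forall>\<^sub>F n in sequentially. ennreal (cumul \<nu> b' - cumul \<nu> b - (run_min f (- real n) b - run_min f (- real n) b'))
        = emeasure \<mu> (?D n)"
      unfolding eventually_sequentially using D by metis
  qed
  ultimately have lim2: "emeasure \<mu> (\<Union>n. ?D n) = emeasure \<nu> {b..b'}"
    using LIMSEQ_unique nu.emeasure_Icc_cumul[OF assms(1)] by fastforce
  \<comment> \<open>A point matched by time \<open>b'\<close> cannot lie beyond \<open>b'\<close>;
    the sets \<open>?D n\<close> miss only \<open>b'\<close> itself.\<close>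
  have "{s. ?M s \<in> {ereal b<..ereal b'}} \<subseteq> (\<Union>n. ?D n) \<union> {b'}"
  proof
    fix s assume s: "s \<in> {s. ?M s \<in> {ereal b<..ereal b'}}"
    then have "s \<le> b'" using match_time_ge[of s f] by (metis ereal_less_eq(3) greaterThanAtMost_iff mem_Collect_eq order_trans)
    moreover obtain n where "- s < real n" using reals_Archimedean2 by blast
    ultimately have "s = b' \<or> s \<in> ?D n" using s by auto
    then show "s \<in> (\<Union>n. ?D n) \<union> {b'}" by blast
  qed
  then have "emeasure \<mu> {s. ?M s \<in> {ereal b<..ereal b'}} \<le> emeasure \<mu> ((\<Union>n. ?D n) \<union> {b'})"
    by (intro emeasure_mono) auto
  also have "\<dots> = emeasure \<mu> (\<Union>n. ?D n)"
    by (rule emeasure_Un_null_set) (auto simp: null_sets_def)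
  finally have "emeasure \<mu> {s. ?M s \<in> {ereal b<..ereal b'}} \<le> emeasure \<mu> (\<Union>n. ?D n)" .
  moreover have "emeasure \<mu> (\<Union>n. ?D n) \<le> emeasure \<mu> {s. ?M s \<in> {ereal b<..ereal b'}}"
    by (intro emeasure_mono) auto
  ultimately show ?thesis using lim2 by simp
qed

text \<open>The image measure and \<open>\<nu>\<close> agree on half-open intervals, which are
  stable under intersection and generate the Borel sets.\<close>

lemma emeasure_match_time:
  assumes lim: "\<And>b b'. b \<le> b' \<Longrightarrow>
      (\<lambda>n. run_min f (- real n) b - run_min f (- real n) b') \<longlonglongrightarrow> 0"
    and C: "C \<in> sets borel"
  shows "(\<integral>\<^sup>+ s. indicator (ereal ` C) (match_time f s) \<partial>\<mu>) = emeasure \<nu> C"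
proof -
  let ?M = "match_time f"
  \<comment> \<open>Points without a finite match are discarded before the push-forward, because
    \<open>real_of_ereal\<close> would send them to 0.\<close>
  define R where "R = distr (density \<mu> (indicator {s. \<bar>?M s\<bar> \<noteq> \<infinity>})) borel (\<lambda>s. real_of_ereal (?M s))"
  have [measurable]: "{s. \<bar>?M s\<bar> \<noteq> \<infinity>} \<in> sets borel" by measurable
  have pre: "{s. \<bar>?M s\<bar> \<noteq> \<infinity>} \<inter> (\<lambda>s. real_of_ereal (?M s)) -` X = {s. ?M s \<in> ereal ` X}" for X
    by (auto simp: image_iff ereal_real')
  have R: "emeasure R X = emeasure \<mu> {s. ?M s \<in> ereal ` X}" 
    and pre_sets: "{s. ?M s \<in> ereal ` X} \<in> sets borel" if X: "X \<in> sets borel" for X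
  proof -
    have vim: "(\<lambda>s. real_of_ereal (?M s)) -` X \<in> sets borel"
      using measurable_sets[of "\<lambda>s. real_of_ereal (?M s)" borel borel X] X by simp
    then show "{s. ?M s \<in> ereal ` X} \<in> sets borel" unfolding pre[symmetric] by simp
    show "emeasure R X = emeasure \<mu> {s. ?M s \<in> ereal ` X}"
      unfolding R_def using X vim by (subst emeasure_distr) (auto simp: emeasure_restricted pre)
  qed
  have Ioc: "emeasure R {a<..b} = emeasure \<nu> {a<..b}" for a b
  proof (cases "a \<le> b")
    case True
    have "ereal ` {a<..b} = {ereal a<..ereal b}"
    proof (intro equalityI subsetI)
      fix x assume "x \<in> {ereal a<..ereal b}"
      then show "x \<in> ereal ` {a<..b}" by (cases x) auto
    qed auto
    then have "emeasure R {a<..b} = emeasure \<nu> {a..b}"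
      using emeasure_match_time_Ioc[OF True lim[OF True]] by (simp add: R)
    also have "{a..b} = {a<..b} \<union> {a}" using True by auto
    also have "emeasure \<nu> ({a<..b} \<union> {a}) = emeasure \<nu> {a<..b}"
      by (rule emeasure_Un_null_set) (auto simp: null_sets_def)
    finally show ?thesis .
  qed simp
  have "R = \<nu>"
  proof (rule measure_eqI_generator_eq[where E = "range (\<lambda>(a, b). {a<..b})" and A = "\<lambda>i. {- real i<..real i}" and \<Omega> = UNIV])
    show "Int_stable (range (\<lambda>(a, b). {a<..b::real}))"
    proof (rule Int_stableI)
      fix A B :: "real set"
      assume "A \<in> range (\<lambda>(a, b). {a<..b})" "B \<in> range (\<lambda>(a, b). {a<..b})"
      then obtain a b c d where "A = {a<..b}" "B = {c<..d}" by auto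
      then have "A \<inter> B = (\<lambda>(a, b). {a<..b}) (max a c, min b d)" by auto
      then show "A \<inter> B \<in> range (\<lambda>(a, b). {a<..b})" by (simp only: rangeI)
    qed
    have "sets (borel :: real measure) = sigma_sets UNIV (range (\<lambda>(a, b). {a<..b}))"
      by (subst borel_sigma_sets_Ioc) simp
    then show "sets R = sigma_sets UNIV (range (\<lambda>(a, b). {a<..b}))"
      "sets \<nu> = sigma_sets UNIV (range (\<lambda>(a, b). {a<..b}))"
      by (simp_all add: R_def)
    show "(\<Union>i. {- real i<..real i}) = UNIV"
    proof (intro equalityI subsetI UNIV_I)
      fix x :: real
      obtain i where "\<bar>x\<bar> < real i" using reals_Archimedean2 by blast
      then have "x \<in> {- real i<..real i}" by auto
      then show "x \<in> (\<Union>i. {- real i<..real i})" by blast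
    qed
    show "emeasure R {- real i<..real i} \<noteq> \<infinity>" for i
      unfolding Ioc using nu.bounded_finite[OF greaterThanAtMost_subseteq_atLeastAtMost_iff[THEN iffD2]]
      by (metis less_irrefl order_refl)
    show "range (\<lambda>(a, b). {a<..b}) \<subseteq> Pow UNIV" by simp
    show "range (\<lambda>i. {- real i<..real i}) \<subseteq> range (\<lambda>(a, b). {a<..b})" by force
    show "emeasure R X = emeasure \<nu> X" if "X \<in> range (\<lambda>(a, b). {a<..b})" for X
      using that Ioc by force
  qed
  have "(\<integral>\<^sup>+ s. indicator (ereal ` C) (?M s) \<partial>\<mu>) = (\<integral>\<^sup>+ s. indicator {s. ?M s \<in> ereal ` C} s \<partial>\<mu>)"
    by (intro nn_integral_cong) (auto simp: indicator_def)
  also have "\<dots> = emeasure R C" using pre_sets[OF C] by (simp add: R C)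
  finally show ?thesis using \<open>R = \<nu>\<close> by simp
qed

end

subsection \<open>Vanishing losses\<close>

text \<open>For the path of a pair of measures, the limit is the mass of the first measure between
  \<open>a\<close> and \<open>a'\<close> that is never matched.\<close>

definition vanishing_gap :: "(real \<Rightarrow> real) \<Rightarrow> real \<Rightarrow> real \<Rightarrow> bool" where
  "vanishing_gap f a a' \<longleftrightarrow> ((\<lambda>b. run_min f a' b - run_min f a b) \<longlongrightarrow> 0) at_top"

context cont_fun
begin

text \<open>The difference is nonnegative and decreasing in \<open>b\<close>, so arbitrarily small
  values force the limit to be 0.\<close>

lemma vanishing_gap_iff:
  assumes "a \<le> a'"
  shows "vanishing_gap f a a' \<longleftrightarrow> (\<forall>e>0. \<exists>b\<ge>a'. run_min f a' b - run_min f a b < e)"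
proof
  assume v: "vanishing_gap f a a'"
  show "\<forall>e>0. \<exists>b\<ge>a'. run_min f a' b - run_min f a b < e"
  proof (intro allI impI)
    fix e :: real assume "e > 0"
    then have "\<forall>\<^sub>F b in at_top. run_min f a' b - run_min f a b < e"
      using v unfolding vanishing_gap_def by (rule order_tendstoD(2)[rotated])
    moreover have "\<forall>\<^sub>F b in at_top. b \<ge> a'" by (rule eventually_ge_at_top)
    ultimately have "\<forall>\<^sub>F b in at_top. b \<ge> a' \<and> run_min f a' b - run_min f a b < e"
      by eventually_elim simp
    then show "\<exists>b\<ge>a'. run_min f a' b - run_min f a b < e"
      using eventually_happens'[OF trivial_limit_at_top_linorder] by blast
  qed
next
  assume e: "\<forall>e>0. \<exists>b\<ge>a'. run_min f a' b - run_min f a b < e"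
  show "vanishing_gap f a a'"
    unfolding vanishing_gap_def
  proof (rule tendstoI)
    fix e :: real assume "e > 0"
    then obtain b where b: "b \<ge> a'" "run_min f a' b - run_min f a b < e" using e by blast
    show "\<forall>\<^sub>F x in at_top. dist (run_min f a' x - run_min f a x) 0 < e"
      unfolding eventually_at_top_linorder
    proof (intro exI allI impI)
      fix x assume x: "x \<ge> b"
      show "dist (run_min f a' x - run_min f a x) 0 < e"
        using run_min_diff_antimono[OF assms b(1) x] run_min_mono_left[of a a' x] assms b x
        by (simp add: dist_real_def)
    qed
  qed
qed

lemma vanishing_gap_trans:
  assumes "vanishing_gap f a b" "vanishing_gap f b c"
  shows "vanishing_gap f a c"
  using tendsto_add[OF assms[unfolded vanishing_gap_def]] by (simp add: vanishing_gap_def)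

lemma vanishing_gap_sub:
  assumes v: "vanishing_gap f a a'" and ab: "a \<le> b" "b \<le> b'" "b' \<le> a'"
  shows "vanishing_gap f b b'"
  unfolding vanishing_gap_iff[OF ab(2)]
proof (intro allI impI)
  fix e :: real assume "e > 0"
  then obtain x where x: "x \<ge> a'" "run_min f a' x - run_min f a x < e"
    using v vanishing_gap_iff[of a a'] ab by auto
  moreover have "run_min f a x \<le> run_min f b x" "run_min f b' x \<le> run_min f a' x"
    using ab x by (auto intro!: run_min_mono_left)
  ultimately show "\<exists>x\<ge>b'. run_min f b' x - run_min f b x < e"
    using ab by (intro exI[of _ x]) auto
qed

text \<open>Adjacent unit intervals can be chained and subintervals inherit a vanishing gap, so a
  grid of unit steps with any offset \<open>t\<close> decides all intervals.\<close>

lemma vanishing_gap_all: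
  assumes v: "\<And>k::int. vanishing_gap f (t + of_int k) (t + of_int k + 1)" and "a \<le> a'"
  shows "vanishing_gap f a a'"
proof -
  have step: "vanishing_gap f (t + of_int k) (t + of_int k + real n)" for k n
  proof (induction n)
    case 0
    then show ?case by (simp add: vanishing_gap_def)
  next
    case (Suc n)
    have "vanishing_gap f (t + of_int k + real n) (t + of_int k + real (Suc n))"
      using v[of "k + int n"] by (simp add: algebra_simps)
    with Suc show ?case by (rule vanishing_gap_trans)
  qed
  define n where "n = nat \<lceil>a' - t - \<lfloor>a - t\<rfloor>\<rceil>"
  have "real n \<ge> a' - t - \<lfloor>a - t\<rfloor>" unfolding n_def by (rule real_nat_ceiling_ge)
  then have "a' \<le> t + of_int \<lfloor>a - t\<rfloor> + real n" by linarith
  moreover have "t + of_int \<lfloor>a - t\<rfloor> \<le> a" by linarith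
  ultimately show ?thesis by (intro vanishing_gap_sub[OF step _ \<open>a \<le> a'\<close>])
qed

lemma vanishing_gap_sequentially:
  "vanishing_gap f a (a + 1) \<longleftrightarrow>
    (\<lambda>n. run_min f (a + 1) (a + 1 + real n) - run_min f a (a + 1 + real n)) \<longlonglongrightarrow> 0"
proof
  assume "vanishing_gap f a (a + 1)"
  moreover have "filterlim (\<lambda>n. a + 1 + real n) at_top sequentially"
    by (intro filterlim_tendsto_add_at_top[OF tendsto_const] filterlim_real_sequentially)
  ultimately show "(\<lambda>n. run_min f (a + 1) (a + 1 + real n) - run_min f a (a + 1 + real n)) \<longlonglongrightarrow> 0"
    unfolding vanishing_gap_def
    by (rule filterlim_compose[where g = "\<lambda>b. run_min f (a + 1) b - run_min f a b" and f = "\<lambda>n. a + 1 + real n"])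
next
  assume lim: "(\<lambda>n. run_min f (a + 1) (a + 1 + real n) - run_min f a (a + 1 + real n)) \<longlonglongrightarrow> 0"
  have "\<exists>b\<ge>a + 1. run_min f (a + 1) b - run_min f a b < e" if "e > 0" for e
  proof -
    have "\<forall>\<^sub>F n in sequentially. run_min f (a + 1) (a + 1 + real n) - run_min f a (a + 1 + real n) < e"
      using lim that by (rule order_tendstoD(2))
    then obtain n where "run_min f (a + 1) (a + 1 + real n) - run_min f a (a + 1 + real n) < e"
      using eventually_happens'[OF sequentially_bot] by blast
    then show ?thesis by (intro exI[of _ "a + 1 + real n"]) simp
  qed
  then show "vanishing_gap f a (a + 1)" by (subst vanishing_gap_iff) auto
qed

text \<open>If the gap persists, the path never returns after \<open>j'\<close> to its minimum over
  \<open>{j..j'}\<close>. Times after \<open>b\<close> then cannot lower a running minimum that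
  starts at or before \<open>j\<close>: a loss of the first measure excludes a later loss of the
  second.\<close>

lemma run_min_eq_if_gap:
  assumes gap: "\<not> vanishing_gap f j j'" and "j \<le> j'" "j' \<le> b" "b \<le> b'" "a \<le> j"
  shows "run_min f a b = run_min f a b'"
proof -
  have "run_min f j b' \<noteq> run_min f j' b'"
    using gap assms unfolding vanishing_gap_iff[OF \<open>j \<le> j'\<close>]
    by (metis order_trans cancel_comm_monoid_add_class.diff_cancel)
  then have "run_min f j b' < run_min f j' b'"
    using run_min_mono_left[of j j' b'] assms by simp
  also have "\<dots> \<le> run_min f b b'" using assms by (intro run_min_mono_left) auto
  finally have "run_min f j b < run_min f b b'"
    using run_min_split[of j b b'] assms by simp
  moreover have "run_min f a b \<le> run_min f j b" using assms by (intro run_min_mono_left) auto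
  ultimately show ?thesis using run_min_split[of a b b'] assms by simp
qed

lemma reflect: "cont_fun (\<lambda>x. f (- x))"
  by unfold_locales (intro isCont_o2[OF _ cont] continuous_intros)

end

lemma run_min_reflect: "run_min (\<lambda>x. f (- x)) a b = run_min f (- b) (- a)"
proof -
  have "(\<lambda>x. f (- x)) ` {a..b} = f ` {- b..- a}"
    by (auto simp: image_iff) (metis atLeastAtMost_iff minus_le_iff minus_minus neg_le_iff_le)+
  then show ?thesis by (simp add: run_min_def)
qed

text \<open>Reversal of time turns losses towards the past into gaps towards the future, so the
  chaining of unit intervals can be reused.\<close>

lemma (in cont_fun) past_gap_vanishes:
  assumes lim: "\<And>k::int. (\<lambda>n. run_min f (of_int k - real n) (of_int k) - run_min f (of_int k - real n) (of_int k + 1)) \<longlonglongrightarrow> 0"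
    and "b \<le> b'"
  shows "(\<lambda>n. run_min f (- real n) b - run_min f (- real n) b') \<longlonglongrightarrow> 0"
proof -
  let ?g = "\<lambda>x. f (- x)"
  interpret g: cont_fun ?g by (rule reflect)
  have "vanishing_gap ?g (0 + of_int k) (0 + of_int k + 1)" for k :: int
  proof -
    \<comment> \<open>Reflection sends the unit interval starting at \<open>k\<close> to the one
      starting at \<open>- k - 1\<close>.\<close>
    have eq: "- (0 + of_int k + 1 + real n) = of_int (- k - 1) - real n"
      "- (0 + of_int k + 1) = (of_int (- k - 1) :: real)" "- (0 + of_int k) = (of_int (- k - 1) + 1 :: real)" for n
      by simp_all
    show ?thesis unfolding g.vanishing_gap_sequentially run_min_reflect eq by (rule lim)
  qed
  then have "vanishing_gap ?g (- b') (- b)"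
    by (rule g.vanishing_gap_all[where t = 0]) (use \<open>b \<le> b'\<close> in simp)
  then have "((\<lambda>x. run_min f (- x) b - run_min f (- x) b') \<longlongrightarrow> 0) at_top"
    unfolding vanishing_gap_def run_min_reflect by simp
  then show ?thesis
    by (rule filterlim_compose[OF _ filterlim_real_sequentially])
qed

section \<open>Time shifts and measure-preserving flows\<close>

lemma cumul_shift:
  assumes "diffuse_radon \<mu>" "diffuse_radon \<mu>'"
    and shift: "\<And>C. C \<in> sets borel \<Longrightarrow> emeasure \<mu>' ((\<lambda>x. x - t) ` C) = emeasure \<mu> C"
  shows "cumul \<mu>' s = cumul \<mu> (s + t) - cumul \<mu> t"
proof -
  interpret mu: diffuse_radon \<mu> by fact
  interpret mu': diffuse_radon \<mu>' by fact
  have eq: "measure \<mu>' {a..b} = measure \<mu> {a + t..b + t}" for a b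
    using shift[of "{a + t..b + t}"]
    by (simp add: measure_def image_minus_const_atLeastAtMost')
  have 0: "cumul \<mu>' 0 = 0" by (simp add: cumul_def measure_def)
  show ?thesis
  proof (cases "0 \<le> s")
    case True
    then show ?thesis
      using mu.cumul_diff[of t "s + t"] mu'.cumul_diff[of 0 s] eq[of 0 s] 0 by simp
  next
    case False
    then show ?thesis
      using mu.cumul_diff[of "s + t" t] mu'.cumul_diff[of s 0] eq[of s 0] 0 by simp
  qed
qed

locale stationary_flow = sigma_finite_measure P for P :: "'w measure" +
  fixes \<theta> :: "real \<Rightarrow> 'w \<Rightarrow> 'w"
  assumes flow: "measurable_flow P \<theta>" and stat: "stationary P \<theta>"
begin

lemma flow_joint [measurable]: "(\<lambda>x. \<theta> (snd x) (fst x)) \<in> measurable (P \<Otimes>\<^sub>M borel) P"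
  using flow by (simp add: measurable_flow_def split_beta')

lemma flow_measurable [measurable]: "\<theta> t \<in> measurable P P"
proof -
  have "(\<lambda>\<omega>. \<theta> (snd (\<omega>, t)) (fst (\<omega>, t))) \<in> measurable P P"
    by (rule measurable_compose[OF _ flow_joint]) simp
  then show ?thesis by simp
qed

lemma flow_in_space [simp]: "\<omega> \<in> space P \<Longrightarrow> \<theta> t \<omega> \<in> space P"
  using measurable_space[OF flow_measurable] .

lemma flow_add: "\<omega> \<in> space P \<Longrightarrow> \<theta> s (\<theta> t \<omega>) = \<theta> (s + t) \<omega>"
  using flow by (simp add: measurable_flow_def)

lemma flow_zero [simp]: "\<omega> \<in> space P \<Longrightarrow> \<theta> 0 \<omega> = \<omega>"
  using flow by (simp add: measurable_flow_def)

lemma flow_vimage: "A \<subseteq> space P \<Longrightarrow> \<theta> t -` A \<inter> space P = \<theta> (- t) ` A"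
proof (intro equalityI subsetI)
  fix \<omega> assume "\<omega> \<in> \<theta> t -` A \<inter> space P"
  then show "\<omega> \<in> \<theta> (- t) ` A" by (intro image_eqI[of _ _ "\<theta> t \<omega>"]) (auto simp: flow_add)
next
  fix \<omega> assume "A \<subseteq> space P" "\<omega> \<in> \<theta> (- t) ` A"
  then show "\<omega> \<in> \<theta> t -` A \<inter> space P" by (auto simp: flow_add subset_iff)
qed

lemma distr_flow: "distr P P (\<theta> t) = P"
proof (rule measure_eqI)
  fix A assume "A \<in> sets (distr P P (\<theta> t))"
  then have A: "A \<in> sets P" by simp
  then have "emeasure (distr P P (\<theta> t)) A = emeasure P (\<theta> (- t) ` A)"
    by (simp add: emeasure_distr flow_vimage sets.sets_into_space)
  then show "emeasure (distr P P (\<theta> t)) A = emeasure P A"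
    using stat A by (simp add: stationary_def)
qed simp

lemma nn_integral_flow: "g \<in> borel_measurable P \<Longrightarrow> (\<integral>\<^sup>+ \<omega>. g (\<theta> t \<omega>) \<partial>P) = (\<integral>\<^sup>+ \<omega>. g \<omega> \<partial>P)"
  using nn_integral_distr[OF flow_measurable, of g t] by (simp add: distr_flow)

lemma integral_flow:
  fixes g :: "'w \<Rightarrow> real"
  shows "g \<in> borel_measurable P \<Longrightarrow> (\<integral>\<omega>. g (\<theta> t \<omega>) \<partial>P) = (\<integral>\<omega>. g \<omega> \<partial>P)"
  using integral_distr[OF flow_measurable, of g t] by (simp add: distr_flow)

lemma AE_flow: "AE \<omega> in P. Q \<omega> \<Longrightarrow> AE \<omega> in P. Q (\<theta> t \<omega>)"
  using AE_distrD[OF flow_measurable[of t], where P = Q] by (simp only: distr_flow)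

lemma AE_flow_int: "AE \<omega> in P. Q \<omega> \<Longrightarrow> AE \<omega> in P. \<forall>k::int. Q (\<theta> (of_int k) \<omega>)"
  unfolding AE_all_countable using AE_flow by blast

text \<open>Null sets for uncountably many times need not have a null union. By Fubini and
  stationarity, almost every orbit still spends Lebesgue-almost no time in the exceptional
  set.\<close>

lemma AE_AE_flow:
  assumes "AE \<omega> in P. Q \<omega>"
  shows "AE \<omega> in P. AE t in lborel. Q (\<theta> t \<omega>)"
proof -
  obtain N where N: "N \<in> sets P" "emeasure P N = 0" "{\<omega> \<in> space P. \<not> Q \<omega>} \<subseteq> N"
    using AE_E[OF assms] by auto
  note [measurable] = N(1)
  interpret pair_sigma_finite P lborel ..
  have "(\<integral>\<^sup>+ \<omega>. (\<integral>\<^sup>+ t. indicator N (\<theta> t \<omega>) \<partial>lborel) \<partial>P) =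
      (\<integral>\<^sup>+ t. (\<integral>\<^sup>+ \<omega>. indicator N (\<theta> t \<omega>) \<partial>P) \<partial>lborel)"
    by (rule Fubini'[symmetric]) measurable
  also have "\<dots> = 0"
    using N by (simp add: nn_integral_flow[of "indicator N"])
  finally have "AE \<omega> in P. (\<integral>\<^sup>+ t. indicator N (\<theta> t \<omega>) \<partial>lborel) = 0"
    by (subst (asm) nn_integral_0_iff_AE) auto
  then show ?thesis
  proof (rule AE_mp[OF _ AE_I2[OF impI]])
    fix \<omega> assume w: "\<omega> \<in> space P" and 0: "(\<integral>\<^sup>+ t. indicator N (\<theta> t \<omega>) \<partial>lborel) = 0"
    have "(\<lambda>t. \<theta> t \<omega>) \<in> measurable lborel P"
      using measurable_compose[OF measurable_Pair1'[OF w, of borel] flow_joint] by simp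
    then have "(\<lambda>t. indicator N (\<theta> t \<omega>) :: ennreal) \<in> borel_measurable lborel" by measurable
    then have "AE t in lborel. (indicator N (\<theta> t \<omega>) :: ennreal) = 0"
      using 0 by (subst (asm) nn_integral_0_iff_AE) auto
    then show "AE t in lborel. Q (\<theta> t \<omega>)"
      by eventually_elim (use N(3) flow_in_space[OF w] in \<open>auto simp: indicator_def subset_iff split: if_splits\<close>)
  qed
qed

text \<open>Averaging over the flow turns almost sure invariance into strict invariance.\<close>

lemma strictly_invariant_version:
  assumes B: "B \<in> sets P"
    and inv: "AE \<omega> in P. AE t in lborel. \<theta> t \<omega> \<in> B \<longleftrightarrow> \<omega> \<in> B"
  obtains A where "A \<in> invariant_sets P \<theta>" "AE \<omega> in P. \<omega> \<in> A \<longleftrightarrow> \<omega> \<in> B"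
proof
  note [measurable] = B
  \<comment> \<open>The time that the orbit spends outside \<open>B\<close>. Translation invariance
    of Lebesgue measure makes it exactly constant along orbits.\<close>
  let ?h = "\<lambda>\<omega>. \<integral>\<^sup>+ t. indicator (space P - B) (\<theta> t \<omega>) \<partial>lborel"
  let ?A = "{\<omega> \<in> space P. ?h \<omega> = 0}"
  have orbit: "(\<lambda>t. \<theta> t \<omega>) \<in> measurable borel P" if "\<omega> \<in> space P" for \<omega>
    using measurable_compose[OF measurable_Pair1'[OF that, of borel] flow_joint] by simp
  have ind: "(\<lambda>t. indicator (space P - B) (\<theta> t \<omega>) :: ennreal) \<in> borel_measurable borel" if "\<omega> \<in> space P" for \<omega>
    by (rule measurable_compose[OF orbit[OF that]]) measurable
  have h_inv: "?h (\<theta> s \<omega>) = ?h \<omega>" if w: "\<omega> \<in> space P" for s \<omega>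
  proof -
    have "?h (\<theta> s \<omega>) = (\<integral>\<^sup>+ t. indicator (space P - B) (\<theta> (s + 1 * t) \<omega>) \<partial>lborel)"
      using w by (simp add: flow_add add.commute)
    also have "\<dots> = ?h \<omega>"
      using nn_integral_real_affine[of "\<lambda>t. indicator (space P - B) (\<theta> t \<omega>)" 1 s] ind[OF w] by simp
    finally show ?thesis .
  qed
  have "(\<lambda>\<omega>. ?h \<omega>) \<in> borel_measurable P"
    by (rule lborel.borel_measurable_nn_integral) (simp add: split_beta', measurable)
  then have "?A \<in> sets P" by measurable
  moreover have "\<theta> s ` ?A = ?A" for s
    using flow_vimage[of ?A "- s"] h_inv by auto
  ultimately show "?A \<in> invariant_sets P \<theta>" by (simp add: invariant_sets_def)
  show "AE \<omega> in P. \<omega> \<in> ?A \<longleftrightarrow> \<omega> \<in> B"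
    using inv
  proof (rule AE_mp[OF _ AE_I2[OF impI]])
    fix \<omega> assume w: "\<omega> \<in> space P" and t: "AE t in lborel. \<theta> t \<omega> \<in> B \<longleftrightarrow> \<omega> \<in> B"
    have "?h \<omega> = 0 \<longleftrightarrow> (AE t in lborel. \<theta> t \<omega> \<in> B)"
      using ind[OF w] w by (subst nn_integral_0_iff_AE) (auto simp: indicator_def)
    also have "\<dots> \<longleftrightarrow> (AE t in (lborel :: real measure). \<omega> \<in> B)"
      using t by (intro iffI; elim AE_mp; elim AE_mp) auto
    \<comment> \<open>A statement not depending on time holds for almost all times only if it holds,
      as the line is not a null set.\<close>
    also have "\<dots> \<longleftrightarrow> \<omega> \<in> B"
      by (auto simp: AE_iff_null null_sets_def)
    finally show "\<omega> \<in> ?A \<longleftrightarrow> \<omega> \<in> B" using w by simp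
  qed
qed

end

subsection \<open>Losses under a stationary flow\<close>

text \<open>
  The kernels of this locale are assumed to be well behaved everywhere. They arise from \<open>\<xi>\<close> and
  \<open>\<eta>\<close> by modification on the null set \<open>N\<close>, and therefore are invariant only as long as the flow
  stays outside \<open>N\<close>, which need not be the case for all times simultaneously.
\<close>

locale coupled_measures = stationary_flow P \<theta> for P :: "'w measure" and \<theta> +
  fixes X Y :: "'w \<Rightarrow> real measure" and N :: "'w set"
  assumes pair: "\<omega> \<in> space P \<Longrightarrow> measure_pair (X \<omega>) (Y \<omega>)"
    and X_meas: "C \<in> sets borel \<Longrightarrow> (\<lambda>\<omega>. emeasure (X \<omega>) C) \<in> borel_measurable P"
    and Y_meas: "C \<in> sets borel \<Longrightarrow> (\<lambda>\<omega>. emeasure (Y \<omega>) C) \<in> borel_measurable P"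
    and N_null: "N \<in> null_sets P"
    and X_shift: "\<omega> \<in> space P \<Longrightarrow> \<omega> \<notin> N \<Longrightarrow> \<theta> t \<omega> \<notin> N \<Longrightarrow> C \<in> sets borel \<Longrightarrow>
      emeasure (X (\<theta> t \<omega>)) ((\<lambda>x. x - t) ` C) = emeasure (X \<omega>) C"
    and Y_shift: "\<omega> \<in> space P \<Longrightarrow> \<omega> \<notin> N \<Longrightarrow> \<theta> t \<omega> \<notin> N \<Longrightarrow> C \<in> sets borel \<Longrightarrow>
      emeasure (Y (\<theta> t \<omega>)) ((\<lambda>x. x - t) ` C) = emeasure (Y \<omega>) C"
    and X_int: "(\<integral>\<^sup>+ \<omega>. emeasure (X \<omega>) {0..1} \<partial>P) < \<infinity>"
    and Y_int: "(\<integral>\<^sup>+ \<omega>. emeasure (Y \<omega>) {0..1} \<partial>P) < \<infinity>"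
    and cond: "A \<in> invariant_sets P \<theta> \<Longrightarrow>
      (\<integral>\<^sup>+ \<omega>. indicator A \<omega> * emeasure (X \<omega>) {0..1} \<partial>P) =
      (\<integral>\<^sup>+ \<omega>. indicator A \<omega> * emeasure (Y \<omega>) {0..1} \<partial>P)"
    and mass: "AE \<omega> in P. emeasure (X \<omega>) UNIV \<in> {0, \<infinity>}"
begin

definition F :: "'w \<Rightarrow> real \<Rightarrow> real" where "F \<omega> = net (X \<omega>) (Y \<omega>)"

lemma X_radon: "\<omega> \<in> space P \<Longrightarrow> diffuse_radon (X \<omega>)"
  using pair unfolding measure_pair_def by blast

lemma Y_radon: "\<omega> \<in> space P \<Longrightarrow> diffuse_radon (Y \<omega>)"
  using pair unfolding measure_pair_def by blast

lemma F_fun: "\<omega> \<in> space P \<Longrightarrow> cont_fun (F \<omega>)"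
  unfolding F_def using measure_pair.cont_fun_net[OF pair] .

lemma cumul_measurable:
  "(\<And>C. C \<in> sets borel \<Longrightarrow> (\<lambda>\<omega>. emeasure (Z \<omega>) C) \<in> borel_measurable P) \<Longrightarrow>
    (\<lambda>\<omega>. cumul (Z \<omega>) t) \<in> borel_measurable P" for Z
  unfolding cumul_def measure_def by (cases "0 \<le> t") auto

sublocale F: cont_process P F
proof
  show "isCont (F \<omega>) t" if "\<omega> \<in> space P" for \<omega> t
    using F_fun[OF that] by (rule cont_fun.cont)
  show "(\<lambda>\<omega>. F \<omega> t) \<in> borel_measurable P" for t
    unfolding F_def net_def
    by (intro borel_measurable_diff cumul_measurable X_meas Y_meas)
qed

abbreviation "M \<omega> \<equiv> run_min (F \<omega>)"

lemma F_shift: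
  assumes "\<omega> \<in> space P" "\<omega> \<notin> N" "\<theta> t \<omega> \<notin> N"
  shows "F (\<theta> t \<omega>) s = F \<omega> (s + t) - F \<omega> t"
proof -
  have "cumul (X (\<theta> t \<omega>)) s = cumul (X \<omega>) (s + t) - cumul (X \<omega>) t"
    using assms by (intro cumul_shift X_radon X_shift flow_in_space)
  moreover have "cumul (Y (\<theta> t \<omega>)) s = cumul (Y \<omega>) (s + t) - cumul (Y \<omega>) t"
    using assms by (intro cumul_shift Y_radon Y_shift flow_in_space)
  ultimately show ?thesis by (simp add: F_def net_def)
qed

text \<open>The term \<open>F \<omega> t\<close> cancels in differences of running minima with the
  same shift, so gaps at \<open>\<theta> t \<omega>\<close> are shifted gaps of the path at
  \<open>\<omega>\<close>.\<close>

lemma M_shift: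
  assumes w: "\<omega> \<in> space P" "\<omega> \<notin> N" "\<theta> t \<omega> \<notin> N" and "a \<le> b"
  shows "M (\<theta> t \<omega>) a b = M \<omega> (a + t) (b + t) - F \<omega> t"
proof -
  interpret f: cont_fun "F \<omega>" by (rule F_fun[OF w(1)])
  interpret g: cont_fun "F (\<theta> t \<omega>)" using w by (intro F_fun) simp
  obtain r where r: "r \<in> {a + t..b + t}" "M \<omega> (a + t) (b + t) = F \<omega> r"
    using f.run_min_attained[of "a + t" "b + t"] \<open>a \<le> b\<close> by (metis add_le_cancel_right)
  show ?thesis
  proof (rule antisym)
    have "M (\<theta> t \<omega>) a b \<le> F (\<theta> t \<omega>) (r - t)"
      using r(1) by (intro g.run_min_le) auto
    then show "M (\<theta> t \<omega>) a b \<le> M \<omega> (a + t) (b + t) - F \<omega> t"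
      using r(2) F_shift[OF w, of "r - t"] by simp
    have "M \<omega> (a + t) (b + t) \<le> F (\<theta> t \<omega>) s + F \<omega> t" if "s \<in> {a..b}" for s
      using that F_shift[OF w, of s] f.run_min_le[of "s + t" "a + t" "b + t"] by simp
    then show "M \<omega> (a + t) (b + t) - F \<omega> t \<le> M (\<theta> t \<omega>) a b"
      by (intro g.le_run_min[OF \<open>a \<le> b\<close>]) (simp add: diff_le_eq)
  qed
qed

text \<open>
  \<open>\<xi>_gap \<omega> n\<close> is the \<open>\<xi>\<close>-mass of the points in \<open>[0,1]\<close> that are not matched up to time \<open>n + 1\<close>, and
  \<open>\<eta>_gap \<omega> n\<close> the \<open>\<eta>\<close>-mass of the points in \<open>[0,1]\<close> that are not matched with points after \<open>-n\<close>.
\<close>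

definition \<xi>_gap :: "'w \<Rightarrow> nat \<Rightarrow> real" where
  "\<xi>_gap \<omega> n = M \<omega> 1 (1 + real n) - M \<omega> 0 (1 + real n)"

definition \<eta>_gap :: "'w \<Rightarrow> nat \<Rightarrow> real" where
  "\<eta>_gap \<omega> n = M \<omega> (- real n) 0 - M \<omega> (- real n) 1"

definition \<xi>_loss :: "'w \<Rightarrow> real" where "\<xi>_loss \<omega> = (INF n. \<xi>_gap \<omega> n)"

definition \<eta>_loss :: "'w \<Rightarrow> real" where "\<eta>_loss \<omega> = (INF n. \<eta>_gap \<omega> n)"

context
  fixes \<omega> assumes w: "\<omega> \<in> space P"
begin

interpretation f: cont_fun "F \<omega>" by (rule F_fun[OF w])
interpretation p: measure_pair "X \<omega>" "Y \<omega>" by (rule pair[OF w])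

lemma \<xi>_gap_nonneg: "0 \<le> \<xi>_gap \<omega> n"
  unfolding \<xi>_gap_def using f.run_min_mono_left[of 0 1 "1 + real n"] by simp

lemma \<eta>_gap_nonneg: "0 \<le> \<eta>_gap \<omega> n"
  unfolding \<eta>_gap_def using f.run_min_antimono_right[of "- real n" 0 1] by simp

lemma \<xi>_gap_decseq: "decseq (\<xi>_gap \<omega>)"
  unfolding decseq_def \<xi>_gap_def by (auto intro!: f.run_min_diff_antimono)

lemma \<eta>_gap_decseq: "decseq (\<eta>_gap \<omega>)"
  unfolding decseq_def
proof (intro allI impI)
  fix m n :: nat assume "m \<le> n"
  then show "\<eta>_gap \<omega> n \<le> \<eta>_gap \<omega> m"
    using f.run_min_split[of "- real n" "- real m" 0] f.run_min_split[of "- real n" "- real m" 1]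
      f.run_min_antimono_right[of "- real m" 0 1]
    by (simp add: \<eta>_gap_def min_def split: if_splits)
qed

lemma \<xi>_gap_le: "\<xi>_gap \<omega> n \<le> measure (X \<omega>) {0..1}"
  using p.run_min_increment[of 0 1 "1 + real n"] p.mu.cumul_diff[of 0 1]
  by (simp add: \<xi>_gap_def F_def)

text \<open>By monotonicity \<open>n = 0\<close> is the worst case. There the gap is the largest
  descent of the path below its value at 0, and only \<open>Y \<omega>\<close> makes the path
  descend.\<close>

lemma \<eta>_gap_le: "\<eta>_gap \<omega> n \<le> measure (Y \<omega>) {0..1}"
proof -
  obtain r where r: "r \<in> {0..1}" "M \<omega> 0 1 = F \<omega> r" using f.run_min_attained[of 0 1] by auto
  have "\<eta>_gap \<omega> n \<le> \<eta>_gap \<omega> 0" using \<eta>_gap_decseq by (simp add: decseq_def)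
  also have "\<dots> = F \<omega> 0 - F \<omega> r" using r by (simp add: \<eta>_gap_def)
  also have "\<dots> \<le> cumul (Y \<omega>) 1 - cumul (Y \<omega>) 0"
    using p.mu.cumul_mono[of 0 r] p.nu.cumul_mono[of r 1] r(1) by (simp add: F_def net_def)
  finally show ?thesis using p.nu.cumul_diff[of 0 1] by simp
qed

lemma \<xi>_gap_lim: "\<xi>_gap \<omega> \<longlonglongrightarrow> \<xi>_loss \<omega>"
  unfolding \<xi>_loss_def using \<xi>_gap_decseq \<xi>_gap_nonneg
  by (intro LIMSEQ_decseq_INF bdd_belowI[of _ 0]) auto

lemma \<eta>_gap_lim: "\<eta>_gap \<omega> \<longlonglongrightarrow> \<eta>_loss \<omega>"
  unfolding \<eta>_loss_def using \<eta>_gap_decseq \<eta>_gap_nonneg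
  by (intro LIMSEQ_decseq_INF bdd_belowI[of _ 0]) auto

lemma \<xi>_loss_nonneg: "0 \<le> \<xi>_loss \<omega>"
  using \<xi>_gap_lim \<xi>_gap_nonneg by (intro LIMSEQ_le_const) auto

lemma \<eta>_loss_nonneg: "0 \<le> \<eta>_loss \<omega>"
  using \<eta>_gap_lim \<eta>_gap_nonneg by (intro LIMSEQ_le_const) auto

lemma \<xi>_loss_le: "\<xi>_loss \<omega> \<le> measure (X \<omega>) {0..1}"
  using \<xi>_gap_lim \<xi>_gap_le by (intro LIMSEQ_le_const2) auto

lemma \<eta>_loss_le: "\<eta>_loss \<omega> \<le> measure (Y \<omega>) {0..1}"
  using \<eta>_gap_lim \<eta>_gap_le by (intro LIMSEQ_le_const2) auto

end

text \<open>Lets losses at different times be compared on the one path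
  \<open>F \<omega>\<close>.\<close>

lemma \<xi>_loss_shift_iff:
  assumes w: "\<omega> \<in> space P" "\<omega> \<notin> N" "\<theta> t \<omega> \<notin> N"
  shows "\<xi>_loss (\<theta> t \<omega>) = 0 \<longleftrightarrow> vanishing_gap (F \<omega>) t (t + 1)"
proof -
  interpret f: cont_fun "F \<omega>" by (rule F_fun[OF w(1)])
  have "\<xi>_gap (\<theta> t \<omega>) = (\<lambda>n. M \<omega> (t + 1) (t + 1 + real n) - M \<omega> t (t + 1 + real n))"
    using w by (simp add: \<xi>_gap_def M_shift algebra_simps fun_eq_iff)
  moreover have "\<xi>_loss (\<theta> t \<omega>) = 0 \<longleftrightarrow> \<xi>_gap (\<theta> t \<omega>) \<longlonglongrightarrow> 0"
    using \<xi>_gap_lim[of "\<theta> t \<omega>"] w by (auto dest: LIMSEQ_unique)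
  ultimately show ?thesis
    unfolding f.vanishing_gap_sequentially by simp
qed

lemma \<eta>_loss_shift_iff:
  assumes w: "\<omega> \<in> space P" "\<omega> \<notin> N" "\<theta> t \<omega> \<notin> N"
  shows "\<eta>_loss (\<theta> t \<omega>) = 0 \<longleftrightarrow> (\<lambda>n. M \<omega> (t - real n) t - M \<omega> (t - real n) (t + 1)) \<longlonglongrightarrow> 0"
proof -
  have "\<eta>_gap (\<theta> t \<omega>) = (\<lambda>n. M \<omega> (t - real n) t - M \<omega> (t - real n) (t + 1))"
    using w by (simp add: \<eta>_gap_def M_shift algebra_simps fun_eq_iff)
  moreover have "\<eta>_loss (\<theta> t \<omega>) = 0 \<longleftrightarrow> \<eta>_gap (\<theta> t \<omega>) \<longlonglongrightarrow> 0"
    using \<eta>_gap_lim[of "\<theta> t \<omega>"] w by (auto dest: LIMSEQ_unique)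
  ultimately show ?thesis by simp
qed

lemma \<xi>_gap_measurable [measurable]: "(\<lambda>\<omega>. \<xi>_gap \<omega> n) \<in> borel_measurable P"
  unfolding \<xi>_gap_def by measurable

lemma \<eta>_gap_measurable [measurable]: "(\<lambda>\<omega>. \<eta>_gap \<omega> n) \<in> borel_measurable P"
  unfolding \<eta>_gap_def by measurable

lemma \<xi>_loss_measurable [measurable]: "\<xi>_loss \<in> borel_measurable P"
  by (rule borel_measurable_LIMSEQ_real[OF \<xi>_gap_lim]) measurable

lemma \<eta>_loss_measurable [measurable]: "\<eta>_loss \<in> borel_measurable P"
  by (rule borel_measurable_LIMSEQ_real[OF \<eta>_gap_lim]) measurable

section \<open>Equality of the integrated losses\<close>

lemma integrable_unit_mass:
  assumes Z: "\<And>C. C \<in> sets borel \<Longrightarrow> (\<lambda>\<omega>. emeasure (Z \<omega>) C) \<in> borel_measurable P"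
    and "\<And>\<omega>. \<omega> \<in> space P \<Longrightarrow> diffuse_radon (Z \<omega>)"
    and "(\<integral>\<^sup>+ \<omega>. emeasure (Z \<omega>) {0..1} \<partial>P) < \<infinity>"
  shows "integrable P (\<lambda>\<omega>. measure (Z \<omega>) {0..1})"
proof (rule integrableI_nonneg)
  show "(\<lambda>\<omega>. measure (Z \<omega>) {0..1}) \<in> borel_measurable P"
    unfolding measure_def using Z[of "{0..1}"] by simp
  have "(\<integral>\<^sup>+ \<omega>. ennreal (measure (Z \<omega>) {0..1}) \<partial>P) = (\<integral>\<^sup>+ \<omega>. emeasure (Z \<omega>) {0..1} \<partial>P)"
    by (intro nn_integral_cong) (simp add: diffuse_radon.emeasure_Icc assms(2))
  then show "(\<integral>\<^sup>+ \<omega>. ennreal (measure (Z \<omega>) {0..1}) \<partial>P) < \<infinity>" using assms(3) by simp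
qed simp

lemma X_integrable: "integrable P (\<lambda>\<omega>. measure (X \<omega>) {0..1})"
  by (rule integrable_unit_mass[OF X_meas X_radon X_int])

lemma Y_integrable: "integrable P (\<lambda>\<omega>. measure (Y \<omega>) {0..1})"
  by (rule integrable_unit_mass[OF Y_meas Y_radon Y_int])

lemma integrable_dominated:
  assumes "integrable P g" "h \<in> borel_measurable P" "B \<in> sets P"
    and "\<And>\<omega>. \<omega> \<in> space P \<Longrightarrow> 0 \<le> h \<omega>" "\<And>\<omega>. \<omega> \<in> space P \<Longrightarrow> h \<omega> \<le> g \<omega>"
  shows "integrable P (\<lambda>\<omega>. indicator B \<omega> * h \<omega> :: real)"
  using assms(1)
  by (rule Bochner_Integration.integrable_bound)
     (use assms in \<open>force simp: indicator_def intro!: AE_I2\<close>)+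

text \<open>Invariance at integer times serves the shift in \<open>gap_integral_eq\<close>;
  invariance at Lebesgue-almost all times yields a strictly invariant version in
  \<open>unit_mass_eq\<close>. All real times at once are not demanded, since an orbit may visit
  \<open>N\<close>.\<close>

definition almost_invariant :: "'w set \<Rightarrow> bool" where
  "almost_invariant B \<longleftrightarrow> B \<in> sets P \<and> (AE \<omega> in P. \<forall>k::int. \<theta> k \<omega> \<in> B \<longleftrightarrow> \<omega> \<in> B) \<and>
    (AE \<omega> in P. AE t in lborel. \<theta> t \<omega> \<in> B \<longleftrightarrow> \<omega> \<in> B)"

lemma unit_mass_eq:
  assumes "almost_invariant B"
  shows "(\<integral>\<omega>. indicator B \<omega> * measure (X \<omega>) {0..1} \<partial>P) = (\<integral>\<omega>. indicator B \<omega> * measure (Y \<omega>) {0..1} \<partial>P)"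
proof -
  have B [measurable]: "B \<in> sets P" using assms by (simp add: almost_invariant_def)
  obtain A where A: "A \<in> invariant_sets P \<theta>" "AE \<omega> in P. \<omega> \<in> A \<longleftrightarrow> \<omega> \<in> B"
    using strictly_invariant_version[OF B] assms unfolding almost_invariant_def by blast
  have eq: "(\<integral>\<omega>. indicator B \<omega> * measure (Z \<omega>) {0..1} \<partial>P) =
      enn2real (\<integral>\<^sup>+ \<omega>. indicator A \<omega> * emeasure (Z \<omega>) {0..1} \<partial>P)"
    if Z: "\<And>C. C \<in> sets borel \<Longrightarrow> (\<lambda>\<omega>. emeasure (Z \<omega>) C) \<in> borel_measurable P"
      "\<And>\<omega>. \<omega> \<in> space P \<Longrightarrow> diffuse_radon (Z \<omega>)" for Z :: "'w \<Rightarrow> real measure"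
  proof -
    have [measurable]: "(\<lambda>\<omega>. measure (Z \<omega>) {0..1}) \<in> borel_measurable P"
      unfolding measure_def using Z(1)[of "{0..1}"] by simp
    have "(\<integral>\<omega>. indicator B \<omega> * measure (Z \<omega>) {0..1} \<partial>P) =
        enn2real (\<integral>\<^sup>+ \<omega>. ennreal (indicator B \<omega> * measure (Z \<omega>) {0..1}) \<partial>P)"
      by (rule integral_eq_nn_integral) auto
    also have "(\<integral>\<^sup>+ \<omega>. ennreal (indicator B \<omega> * measure (Z \<omega>) {0..1}) \<partial>P) =
        (\<integral>\<^sup>+ \<omega>. indicator A \<omega> * emeasure (Z \<omega>) {0..1} \<partial>P)"
      by (intro nn_integral_cong_AE AE_mp[OF A(2) AE_I2])
        (auto simp: indicator_def diffuse_radon.emeasure_Icc Z(2))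
    finally show ?thesis .
  qed
  show ?thesis
    using eq[of X, OF X_meas X_radon] eq[of Y, OF Y_meas Y_radon] cond[OF A(1)] by simp
qed

lemma AE_good: "AE \<omega> in P. \<omega> \<notin> N"
  using N_null by (rule AE_not_in)

text \<open>A mass transport argument: the mass leaving \<open>{0..1}\<close> that gets matched
  between times \<open>n + 1\<close> and \<open>n + 2\<close> becomes, after a shift by
  \<open>n + 1\<close>, the mass arriving in \<open>{0..1}\<close> from between
  \<open>- n - 1\<close> and \<open>- n\<close>. Hence both gaps have equal mean decrements on
  \<open>B\<close>, and for \<open>n = 0\<close> the claim reduces to the equality of the unit
  masses.\<close>

lemma gap_integral_eq:
  assumes B: "almost_invariant B"
  shows "(\<integral>\<omega>. indicator B \<omega> * \<xi>_gap \<omega> n \<partial>P) = (\<integral>\<omega>. indicator B \<omega> * \<eta>_gap \<omega> n \<partial>P)"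
proof (induction n)
  have Bs [measurable]: "B \<in> sets P" using B by (simp add: almost_invariant_def)
  have xi_int: "integrable P (\<lambda>\<omega>. indicator B \<omega> * \<xi>_gap \<omega> n)" for n
    by (rule integrable_dominated[OF X_integrable]) (auto intro: \<xi>_gap_nonneg \<xi>_gap_le)
  have eta_int: "integrable P (\<lambda>\<omega>. indicator B \<omega> * \<eta>_gap \<omega> n)" for n
    by (rule integrable_dominated[OF Y_integrable]) (auto intro: \<eta>_gap_nonneg \<eta>_gap_le)
  {
    case 0
    have Xi: "integrable P (\<lambda>\<omega>. indicator B \<omega> * measure (X \<omega>) {0..1})"
      by (rule integrable_dominated[OF X_integrable]) (use X_integrable in auto)
    have Yi: "integrable P (\<lambda>\<omega>. indicator B \<omega> * measure (Y \<omega>) {0..1})"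
      by (rule integrable_dominated[OF Y_integrable]) (use Y_integrable in auto)
    have "(\<integral>\<omega>. indicator B \<omega> * \<xi>_gap \<omega> 0 \<partial>P) - (\<integral>\<omega>. indicator B \<omega> * \<eta>_gap \<omega> 0 \<partial>P) =
        (\<integral>\<omega>. indicator B \<omega> * \<xi>_gap \<omega> 0 - indicator B \<omega> * \<eta>_gap \<omega> 0 \<partial>P)"
      using xi_int eta_int by simp
    also have "\<dots> = (\<integral>\<omega>. indicator B \<omega> * measure (X \<omega>) {0..1} - indicator B \<omega> * measure (Y \<omega>) {0..1} \<partial>P)"
    proof (rule Bochner_Integration.integral_cong[OF refl])
      fix \<omega> assume w: "\<omega> \<in> space P"
      interpret f: cont_fun "F \<omega>" by (rule F_fun[OF w])
      \<comment> \<open>Both gaps contain the minimum over \<open>{0..1}\<close>, which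
        cancels.\<close>
      have "\<xi>_gap \<omega> 0 - \<eta>_gap \<omega> 0 = F \<omega> 1 - F \<omega> 0"
        by (simp add: \<xi>_gap_def \<eta>_gap_def)
      also have "\<dots> = measure (X \<omega>) {0..1} - measure (Y \<omega>) {0..1}"
        using diffuse_radon.cumul_diff[OF X_radon[OF w], of 0 1] diffuse_radon.cumul_diff[OF Y_radon[OF w], of 0 1]
        by (simp add: F_def net_def)
      finally show "indicator B \<omega> * \<xi>_gap \<omega> 0 - indicator B \<omega> * \<eta>_gap \<omega> 0 =
          indicator B \<omega> * measure (X \<omega>) {0..1} - indicator B \<omega> * measure (Y \<omega>) {0..1}"
        by (simp flip: right_diff_distrib)
    qed
    also have "\<dots> = 0" using Xi Yi unit_mass_eq[OF B] by simp
    finally show ?case by simp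
  next
    case (Suc n)
    let ?t = "- real (Suc n)"
    have "(\<integral>\<omega>. indicator B \<omega> * \<xi>_gap \<omega> n \<partial>P) - (\<integral>\<omega>. indicator B \<omega> * \<xi>_gap \<omega> (Suc n) \<partial>P) =
        (\<integral>\<omega>. indicator B \<omega> * (\<xi>_gap \<omega> n - \<xi>_gap \<omega> (Suc n)) \<partial>P)"
      using xi_int by (simp add: right_diff_distrib)
    also have "\<dots> = (\<integral>\<omega>. indicator B (\<theta> ?t \<omega>) * (\<xi>_gap (\<theta> ?t \<omega>) n - \<xi>_gap (\<theta> ?t \<omega>) (Suc n)) \<partial>P)"
      by (rule integral_flow[symmetric]) measurable
    also have "\<dots> = (\<integral>\<omega>. indicator B \<omega> * (\<eta>_gap \<omega> n - \<eta>_gap \<omega> (Suc n)) \<partial>P)"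
    proof (rule integral_cong_AE)
      have "AE \<omega> in P. \<forall>k::int. \<theta> k \<omega> \<in> B \<longleftrightarrow> \<omega> \<in> B"
        using B by (simp add: almost_invariant_def)
      then have 1: "AE \<omega> in P. \<theta> ?t \<omega> \<in> B \<longleftrightarrow> \<omega> \<in> B"
        by eventually_elim (metis of_int_minus of_int_of_nat_eq)
      show "AE \<omega> in P. indicator B (\<theta> ?t \<omega>) * (\<xi>_gap (\<theta> ?t \<omega>) n - \<xi>_gap (\<theta> ?t \<omega>) (Suc n)) =
          indicator B \<omega> * (\<eta>_gap \<omega> n - \<eta>_gap \<omega> (Suc n))"
        using 1 AE_good AE_flow[OF AE_good, of ?t] AE_space
      proof eventually_elim
        case (elim \<omega>)
        \<comment> \<open>Both sides expand to the same four running minima, started at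
          \<open>- real n\<close> or \<open>- real (Suc n)\<close> and ended at 0 or 1.\<close>
        have "\<xi>_gap (\<theta> ?t \<omega>) n - \<xi>_gap (\<theta> ?t \<omega>) (Suc n) = \<eta>_gap \<omega> n - \<eta>_gap \<omega> (Suc n)"
          using M_shift[OF elim(4,2,3), of 1 "1 + real n"] M_shift[OF elim(4,2,3), of 0 "1 + real n"]
            M_shift[OF elim(4,2,3), of 1 "1 + real (Suc n)"] M_shift[OF elim(4,2,3), of 0 "1 + real (Suc n)"]
          by (simp add: \<xi>_gap_def \<eta>_gap_def)
        then show ?case using elim(1) by (simp add: indicator_def)
      qed
    qed measurable
    also have "\<dots> = (\<integral>\<omega>. indicator B \<omega> * \<eta>_gap \<omega> n \<partial>P) - (\<integral>\<omega>. indicator B \<omega> * \<eta>_gap \<omega> (Suc n) \<partial>P)"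
      using eta_int by (simp add: right_diff_distrib)
    finally show ?case using Suc by simp
  }
qed

lemma loss_integral_eq:
  assumes B: "almost_invariant B"
  shows "(\<integral>\<omega>. indicator B \<omega> * \<xi>_loss \<omega> \<partial>P) = (\<integral>\<omega>. indicator B \<omega> * \<eta>_loss \<omega> \<partial>P)"
proof (rule LIMSEQ_unique)
  have [measurable]: "B \<in> sets P" using B by (simp add: almost_invariant_def)
  show "(\<lambda>n. \<integral>\<omega>. indicator B \<omega> * \<xi>_gap \<omega> n \<partial>P) \<longlonglongrightarrow> (\<integral>\<omega>. indicator B \<omega> * \<xi>_loss \<omega> \<partial>P)"
    by (rule integral_dominated_convergence[OF _ _ X_integrable])
       (auto intro!: AE_I2 tendsto_mult \<xi>_gap_lim simp: indicator_def \<xi>_gap_nonneg \<xi>_gap_le)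
  show "(\<lambda>n. \<integral>\<omega>. indicator B \<omega> * \<xi>_gap \<omega> n \<partial>P) \<longlonglongrightarrow> (\<integral>\<omega>. indicator B \<omega> * \<eta>_loss \<omega> \<partial>P)"
    unfolding gap_integral_eq[OF B]
    by (rule integral_dominated_convergence[OF _ _ Y_integrable])
       (auto intro!: AE_I2 tendsto_mult \<eta>_gap_lim simp: indicator_def \<eta>_gap_nonneg \<eta>_gap_le)
qed

text \<open>The losses are nonnegative, so each vanishes almost everywhere on \<open>B\<close>
  exactly if its integral over \<open>B\<close> is 0, and these integrals agree.\<close>

lemma loss_zero_transfer:
  assumes B: "almost_invariant B"
  shows "(AE \<omega> in P. \<omega> \<in> B \<longrightarrow> \<xi>_loss \<omega> = 0) \<longleftrightarrow> (AE \<omega> in P. \<omega> \<in> B \<longrightarrow> \<eta>_loss \<omega> = 0)"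
proof -
  have [measurable]: "B \<in> sets P" using B by (simp add: almost_invariant_def)
  have iff: "(AE \<omega> in P. \<omega> \<in> B \<longrightarrow> h \<omega> = 0) \<longleftrightarrow> (\<integral>\<omega>. indicator B \<omega> * h \<omega> \<partial>P) = 0"
    if "integrable P (\<lambda>\<omega>. indicator B \<omega> * h \<omega>)" "\<And>\<omega>. \<omega> \<in> space P \<Longrightarrow> 0 \<le> h \<omega>" for h :: "'w \<Rightarrow> real"
  proof -
    have "AE \<omega> in P. 0 \<le> indicator B \<omega> * h \<omega>" using that(2) by (intro AE_I2) simp
    then have "(\<integral>\<omega>. indicator B \<omega> * h \<omega> \<partial>P) = 0 \<longleftrightarrow> (AE \<omega> in P. indicator B \<omega> * h \<omega> = 0)"
      by (rule integral_nonneg_eq_0_iff_AE[OF that(1)])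
    also have "\<dots> \<longleftrightarrow> (AE \<omega> in P. \<omega> \<in> B \<longrightarrow> h \<omega> = 0)"
      by (intro AE_cong) (simp add: indicator_def)
    finally show ?thesis by simp
  qed
  have "integrable P (\<lambda>\<omega>. indicator B \<omega> * \<xi>_loss \<omega>)"
    by (rule integrable_dominated[OF X_integrable]) (auto intro: \<xi>_loss_nonneg \<xi>_loss_le)
  moreover have "integrable P (\<lambda>\<omega>. indicator B \<omega> * \<eta>_loss \<omega>)"
    by (rule integrable_dominated[OF Y_integrable]) (auto intro: \<eta>_loss_nonneg \<eta>_loss_le)
  ultimately show ?thesis
    by (simp add: iff \<xi>_loss_nonneg \<eta>_loss_nonneg loss_integral_eq[OF B])
qed

section \<open>Absence of losses on almost every path\<close>

definition first_loss :: "'w set" where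
  "first_loss = {\<omega> \<in> space P. 0 < \<xi>_loss \<omega> \<and> (\<forall>j. \<xi>_loss (\<theta> (- real (Suc j)) \<omega>) = 0)}"

lemma first_loss_sets [measurable]: "first_loss \<in> sets P"
  unfolding first_loss_def by measurable

lemma first_loss_unique:
  fixes i j :: int
  assumes w: "\<omega> \<in> space P" and "\<theta> i \<omega> \<in> first_loss" "\<theta> j \<omega> \<in> first_loss"
  shows "i = j"
proof -
  have "\<not> j < i" if "\<theta> i \<omega> \<in> first_loss" "\<theta> j \<omega> \<in> first_loss" for i j :: int
  proof
    assume "j < i"
    then obtain n where "i = j + int (Suc n)"
      by (metis zless_iff_Suc_zadd)
    then have "\<theta> (- real (Suc n)) (\<theta> i \<omega>) = \<theta> j \<omega>" using w by (simp add: flow_add)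
    moreover have "\<xi>_loss (\<theta> (- real (Suc n)) (\<theta> i \<omega>)) = 0" "0 < \<xi>_loss (\<theta> j \<omega>)"
      using that unfolding first_loss_def by blast+
    ultimately show False by simp
  qed
  then show ?thesis using assms by (meson linorder_neqE_linordered_idom)
qed

text \<open>
  The translates of \<open>first_loss\<close> by integer times are disjoint, so the total \<open>\<xi>\<close>-mass of the line
  integrated over this set is at most the intensity. As \<open>\<xi>\<close> has infinite total mass there, the set is
  null.
\<close>

lemma first_loss_null: "AE \<omega> in P. \<omega> \<notin> first_loss"
proof -
  let ?x = "\<lambda>\<omega>. emeasure (X \<omega>) {0..1}"
  let ?f = "\<lambda>n \<omega>. indicator first_loss \<omega> * emeasure (X \<omega>) {- real n..real n}"
  have [measurable]: "?x \<in> borel_measurable P" "(\<lambda>\<omega>. emeasure (X \<omega>) {a..b}) \<in> borel_measurable P" for a b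
    by (intro X_meas; simp)+
  have le: "(\<integral>\<^sup>+ \<omega>. ?f n \<omega> \<partial>P) \<le> (\<integral>\<^sup>+ \<omega>. ?x \<omega> \<partial>P)" for n
  proof -
    let ?J = "{- int n..<int n}"
    define A where "A j = {\<omega> \<in> space P. \<theta> (- real_of_int j) \<omega> \<in> first_loss}" for j :: int
    have A [measurable]: "A j \<in> sets P" for j unfolding A_def by measurable
    have disj: "disjoint_family_on A ?J"
      unfolding disjoint_family_on_def
    proof (intro ballI impI equals0I)
      fix i j \<omega> assume "i \<noteq> j" "\<omega> \<in> A i \<inter> A j"
      then show False using first_loss_unique[of \<omega> "- i" "- j"] by (simp add: A_def)
    qed
    \<comment> \<open>The interval is cut into unit cells; by invariance the cell starting at
      \<open>j\<close> carries the unit mass seen at \<open>\<theta> j \<omega>\<close>.\<close>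
    have "(\<integral>\<^sup>+ \<omega>. ?f n \<omega> \<partial>P) \<le> (\<integral>\<^sup>+ \<omega>. (\<Sum>j\<in>?J. indicator first_loss \<omega> * ?x (\<theta> j \<omega>)) \<partial>P)"
    proof (rule nn_integral_mono_AE)
      have good: "AE \<omega> in P. \<forall>k::int. \<theta> k \<omega> \<notin> N" by (rule AE_flow_int[OF AE_good])
      show "AE \<omega> in P. ?f n \<omega> \<le> (\<Sum>j\<in>?J. indicator first_loss \<omega> * ?x (\<theta> j \<omega>))"
        using good AE_space
      proof eventually_elim
        case (elim \<omega>)
        interpret x: diffuse_radon "X \<omega>" by (rule X_radon[OF elim(2)])
        have x: "?x (\<theta> j \<omega>) = emeasure (X \<omega>) {real_of_int j..real_of_int j + 1}" for j :: int
        proof -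
          have "\<omega> \<notin> N" using elim(1)[rule_format, of 0] elim(2) by simp
          then have "emeasure (X (\<theta> j \<omega>)) ((\<lambda>x. x - real_of_int j) ` {real_of_int j..real_of_int j + 1}) =
              emeasure (X \<omega>) {real_of_int j..real_of_int j + 1}"
            using elim by (intro X_shift) auto
          then show ?thesis by (simp add: image_minus_const_atLeastAtMost')
        qed
        have "{- real n..real n} \<subseteq> (\<Union>j\<in>?J. {real_of_int j..real_of_int j + 1}) \<union> {real n}"
        proof
          fix s assume s: "s \<in> {- real n..real n}"
          show "s \<in> (\<Union>j\<in>?J. {real_of_int j..real_of_int j + 1}) \<union> {real n}"
          proof (cases "s = real n")
            case False
            then have "\<lfloor>s\<rfloor> \<in> ?J" using s by (auto simp: le_floor_iff floor_less_iff)
            moreover have "s \<in> {real_of_int \<lfloor>s\<rfloor>..real_of_int \<lfloor>s\<rfloor> + 1}" by (simp add: less_imp_le)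
            ultimately show ?thesis by blast
          qed simp
        qed
        then have "emeasure (X \<omega>) {- real n..real n} \<le>
            emeasure (X \<omega>) ((\<Union>j\<in>?J. {real_of_int j..real_of_int j + 1}) \<union> {real n})"
          by (intro emeasure_mono) auto
        also have "\<dots> = emeasure (X \<omega>) (\<Union>j\<in>?J. {real_of_int j..real_of_int j + 1})"
          by (intro emeasure_Un_null_set) (auto simp: null_sets_def)
        also have "\<dots> \<le> (\<Sum>j\<in>?J. emeasure (X \<omega>) {real_of_int j..real_of_int j + 1})"
          by (intro emeasure_subadditive_finite) auto
        finally show ?case
          unfolding x sum_distrib_left[symmetric] by (rule mult_left_mono) simp
      qed
    qed
    also have "\<dots> = (\<Sum>j\<in>?J. \<integral>\<^sup>+ \<omega>. indicator first_loss \<omega> * ?x (\<theta> j \<omega>) \<partial>P)"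
      by (rule nn_integral_sum) measurable
    also have "\<dots> = (\<Sum>j\<in>?J. \<integral>\<^sup>+ \<omega>. indicator (A j) \<omega> * ?x \<omega> \<partial>P)"
    proof (rule sum.cong[OF refl])
      fix j :: int
      \<comment> \<open>Stationarity moves the shift from the mass to the indicator. The resulting
        sets \<open>A j\<close> are disjoint, so the sum is at most the intensity, uniformly in
        \<open>n\<close>.\<close>
      have "(\<integral>\<^sup>+ \<omega>. indicator first_loss \<omega> * ?x (\<theta> j \<omega>) \<partial>P) =
          (\<integral>\<^sup>+ \<omega>. indicator first_loss (\<theta> (- real_of_int j) \<omega>) * ?x (\<theta> j (\<theta> (- real_of_int j) \<omega>)) \<partial>P)"
        by (rule nn_integral_flow[symmetric]) measurable
      also have "\<dots> = (\<integral>\<^sup>+ \<omega>. indicator (A j) \<omega> * ?x \<omega> \<partial>P)"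
        by (rule nn_integral_cong) (simp add: flow_add A_def indicator_def)
      finally show "(\<integral>\<^sup>+ \<omega>. indicator first_loss \<omega> * ?x (\<theta> j \<omega>) \<partial>P) = (\<integral>\<^sup>+ \<omega>. indicator (A j) \<omega> * ?x \<omega> \<partial>P)" .
    qed
    also have "\<dots> = (\<integral>\<^sup>+ \<omega>. (\<Sum>j\<in>?J. indicator (A j) \<omega> * ?x \<omega>) \<partial>P)"
      by (rule nn_integral_sum[symmetric]) measurable
    also have "\<dots> = (\<integral>\<^sup>+ \<omega>. indicator (\<Union>j\<in>?J. A j) \<omega> * ?x \<omega> \<partial>P)"
      by (simp add: indicator_UN_disjoint disj sum_distrib_right)
    also have "\<dots> \<le> (\<integral>\<^sup>+ \<omega>. ?x \<omega> \<partial>P)"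
      by (intro nn_integral_mono) (simp add: indicator_def)
    finally show ?thesis .
  qed
  have "(\<integral>\<^sup>+ \<omega>. (SUP n. ?f n \<omega>) \<partial>P) = (SUP n. \<integral>\<^sup>+ \<omega>. ?f n \<omega> \<partial>P)"
  proof (rule nn_integral_monotone_convergence_SUP_AE)
    fix n
    show "AE \<omega> in P. ?f n \<omega> \<le> ?f (Suc n) \<omega>"
      using X_radon by (intro AE_I2 mult_left_mono emeasure_mono) (auto simp: diffuse_radon.sets_eq)
  qed measurable
  also have "\<dots> \<le> (\<integral>\<^sup>+ \<omega>. ?x \<omega> \<partial>P)" by (rule SUP_least) (rule le)
  also have "\<dots> < \<infinity>" by (rule X_int)
  finally have "AE \<omega> in P. (SUP n. ?f n \<omega>) \<noteq> \<infinity>"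
    by (intro nn_integral_PInf_AE) auto
  then show ?thesis
    using mass AE_space
  proof eventually_elim
    case (elim \<omega>)
    show ?case
    proof
      assume L: "\<omega> \<in> first_loss"
      interpret x: diffuse_radon "X \<omega>" by (rule X_radon[OF elim(3)])
      have "(SUP n. ?f n \<omega>) = (SUP n. emeasure (X \<omega>) {- real n..real n})" using L by simp
      also have "\<dots> = emeasure (X \<omega>) (\<Union>n. {- real n..real n})"
        by (rule SUP_emeasure_incseq) (auto simp: incseq_def)
      also have "(\<Union>n. {- real n..real n}) = UNIV"
      proof (intro equalityI subsetI UNIV_I)
        fix s :: real
        obtain n where "\<bar>s\<bar> \<le> real n" using real_arch_simple by blast
        then have "s \<in> {- real n..real n}" by auto
        then show "s \<in> (\<Union>n. {- real n..real n})" by blast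
      qed
      \<comment> \<open>The supremum is finite, so \<open>mass\<close> leaves only the value 0,
        which is incompatible with a positive loss on \<open>{0..1}\<close>.\<close>
      finally have "emeasure (X \<omega>) UNIV = 0" using elim by auto
      then have "emeasure (X \<omega>) {0..1} = 0"
        using emeasure_mono[of "{0..1}" UNIV "X \<omega>"] by simp
      then have "measure (X \<omega>) {0..1} = 0" by (simp add: measure_def)
      then show False using L \<xi>_loss_le[OF elim(3)] by (simp add: first_loss_def)
    qed
  qed
qed

definition lossless :: "'w set" where
  "lossless = {\<omega> \<in> space P. \<forall>k::int. \<xi>_loss (\<theta> k \<omega>) = 0}"

lemma lossless_flow_int: "\<omega> \<in> space P \<Longrightarrow> \<theta> (real_of_int j) \<omega> \<in> lossless \<longleftrightarrow> \<omega> \<in> lossless"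
proof -
  assume w: "\<omega> \<in> space P"
  have "(\<forall>k::int. \<xi>_loss (\<theta> (real_of_int k + real_of_int j) \<omega>) = 0) \<longleftrightarrow> (\<forall>k::int. \<xi>_loss (\<theta> k \<omega>) = 0)"
    by (metis of_int_add diff_add_cancel)
  then show ?thesis using w by (simp add: lossless_def flow_add)
qed

text \<open>The right-hand side does not involve \<open>t\<close>; this gives the invariance of
  \<open>lossless\<close> at almost all times.\<close>

lemma lossless_iff:
  assumes w: "\<omega> \<in> space P" "\<omega> \<notin> N" "\<And>k::int. \<theta> k (\<theta> t \<omega>) \<notin> N"
  shows "\<theta> t \<omega> \<in> lossless \<longleftrightarrow> (\<forall>a a'. a \<le> a' \<longrightarrow> vanishing_gap (F \<omega>) a a')"
proof -
  interpret f: cont_fun "F \<omega>" by (rule F_fun[OF w(1)])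
  have "\<xi>_loss (\<theta> k (\<theta> t \<omega>)) = 0 \<longleftrightarrow> vanishing_gap (F \<omega>) (t + k) (t + k + 1)" for k :: int
    using \<xi>_loss_shift_iff[OF w(1,2), of "t + k"] w(3)[of k] w(1) by (simp add: flow_add add.commute)
  then have "\<theta> t \<omega> \<in> lossless \<longleftrightarrow> (\<forall>k::int. vanishing_gap (F \<omega>) (t + k) (t + k + 1))"
    using w(1) by (simp add: lossless_def)
  also have "\<dots> \<longleftrightarrow> (\<forall>a a'. a \<le> a' \<longrightarrow> vanishing_gap (F \<omega>) a a')"
    using f.vanishing_gap_all[of t] by (metis less_add_one less_imp_le)
  finally show ?thesis .
qed

lemma lossless_almost_invariant: "almost_invariant lossless"
  unfolding almost_invariant_def
proof (intro conjI)
  show "lossless \<in> sets P" unfolding lossless_def by measurable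
  show "AE \<omega> in P. \<forall>k::int. \<theta> k \<omega> \<in> lossless \<longleftrightarrow> \<omega> \<in> lossless"
    by (intro AE_I2 allI lossless_flow_int)
  have good: "AE \<omega> in P. \<forall>k::int. \<theta> k \<omega> \<notin> N" by (rule AE_flow_int[OF AE_good])
  show "AE \<omega> in P. AE t in lborel. \<theta> t \<omega> \<in> lossless \<longleftrightarrow> \<omega> \<in> lossless"
    using AE_AE_flow[OF good] good AE_good AE_space
  proof (eventually_elim)
    case (elim \<omega>)
    have "\<omega> \<in> lossless \<longleftrightarrow> (\<forall>a a'. a \<le> a' \<longrightarrow> vanishing_gap (F \<omega>) a a')"
      using lossless_iff[of \<omega> 0] elim(2-4) by simp
    then show ?case
      using elim(1) lossless_iff[OF elim(4,3)] by (auto elim!: AE_mp)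
  qed
qed

lemma complement_almost_invariant: "almost_invariant B \<Longrightarrow> almost_invariant (space P - B)"
  unfolding almost_invariant_def
proof (elim conjE, intro conjI)
  show "AE \<omega> in P. \<forall>k::int. \<theta> k \<omega> \<in> space P - B \<longleftrightarrow> \<omega> \<in> space P - B"
    if "AE \<omega> in P. \<forall>k::int. \<theta> k \<omega> \<in> B \<longleftrightarrow> \<omega> \<in> B"
    using that AE_space by eventually_elim simp
  show "AE \<omega> in P. AE t in lborel. \<theta> t \<omega> \<in> space P - B \<longleftrightarrow> \<omega> \<in> space P - B"
    if "AE \<omega> in P. AE t in lborel. \<theta> t \<omega> \<in> B \<longleftrightarrow> \<omega> \<in> B"
    using that AE_space
  proof eventually_elim
    case (elim \<omega>)
    then show ?case by (auto elim!: AE_mp)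
  qed
qed simp

text \<open>Otherwise the least nonnegative integer time of loss would be a first one. The bound
  \<open>-1\<close> ensures that the unit interval of the loss ends by time 0.\<close>

lemma early_loss:
  assumes w: "\<omega> \<in> space P" "\<omega> \<notin> lossless" and first: "\<And>k::int. \<theta> k \<omega> \<notin> first_loss"
  shows "\<exists>k::int \<le> -1. \<xi>_loss (\<theta> k \<omega>) \<noteq> 0"
proof (rule ccontr)
  assume "\<not> (\<exists>k::int \<le> -1. \<xi>_loss (\<theta> k \<omega>) \<noteq> 0)"
  then have neg: "\<xi>_loss (\<theta> (real_of_int k) \<omega>) = 0" if "k \<le> -1" for k using that by blast
  obtain k :: int where k: "\<xi>_loss (\<theta> k \<omega>) \<noteq> 0" using w by (auto simp: lossless_def)
  then have "k \<ge> 0" using neg[of k] by linarith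
  then have ex: "\<xi>_loss (\<theta> (real (nat k)) \<omega>) \<noteq> 0" using k by simp
  define n where "n = (LEAST n. \<xi>_loss (\<theta> (real n) \<omega>) \<noteq> 0)"
  have n: "\<xi>_loss (\<theta> (real n) \<omega>) \<noteq> 0" unfolding n_def using ex by (rule LeastI)
  have small: "\<xi>_loss (\<theta> (real m) \<omega>) = 0" if "m < n" for m
    using not_less_Least that unfolding n_def by blast
  have "\<xi>_loss (\<theta> (- real (Suc j)) (\<theta> (real n) \<omega>)) = 0" for j
  proof (cases "Suc j \<le> n")
    case True
    then have "- real (Suc j) + real n = real (n - Suc j)" by (simp add: of_nat_diff)
    then show ?thesis using w(1) small[of "n - Suc j"] True by (simp only: flow_add)
  next
    case False
    have "- real (Suc j) + real n = real_of_int (int n - int (Suc j))" by simp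
    then show ?thesis using w(1) neg[of "int n - int (Suc j)"] False by (simp only: flow_add)
  qed
  moreover have "0 < \<xi>_loss (\<theta> (real n) \<omega>)"
    using n \<xi>_loss_nonneg[of "\<theta> (real n) \<omega>"] w(1) by simp
  ultimately have "\<theta> (real_of_int (int n)) \<omega> \<in> first_loss"
    using w(1) by (simp add: first_loss_def)
  then show False using first by blast
qed

lemma AE_lossless: "AE \<omega> in P. \<omega> \<in> lossless"
proof -
  have good: "AE \<omega> in P. \<forall>k::int. \<theta> k \<omega> \<notin> N" by (rule AE_flow_int[OF AE_good])
  have "AE \<omega> in P. \<omega> \<in> space P - lossless \<longrightarrow> \<eta>_loss \<omega> = 0"
    using AE_flow_int[OF first_loss_null] good AE_good AE_space
  proof (eventually_elim, intro impI)
    fix \<omega> assume first: "\<forall>k::int. \<theta> k \<omega> \<notin> first_loss" and g: "\<forall>k::int. \<theta> k \<omega> \<notin> N" "\<omega> \<notin> N"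
      and w: "\<omega> \<in> space P" and "\<omega> \<in> space P - lossless"
    then obtain k :: int where k: "k \<le> -1" "\<xi>_loss (\<theta> k \<omega>) \<noteq> 0"
      using early_loss[of \<omega>] by blast
    interpret f: cont_fun "F \<omega>" by (rule F_fun[OF w])
    have "\<not> vanishing_gap (F \<omega>) (real_of_int k) (real_of_int k + 1)"
      using \<xi>_loss_shift_iff[OF w g(2), of k] g(1) k(2) by blast
    moreover have "real_of_int k + 1 \<le> 0" using k(1) by linarith
    \<comment> \<open>The loss on the interval from \<open>k\<close> to \<open>k + 1\<close> happens
      before time 0, so the minimum started at \<open>k\<close> is not lowered between 0 and 1. Thus
      a single gap, and with it the limit, is 0.\<close>
    ultimately have "M \<omega> (- real (nat (- k))) 0 = M \<omega> (- real (nat (- k))) 1"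
      using k(1) by (intro f.run_min_eq_if_gap[of "real_of_int k" "real_of_int k + 1"]) auto
    then have "\<eta>_gap \<omega> (nat (- k)) = 0" by (simp add: \<eta>_gap_def)
    then have "\<eta>_loss \<omega> \<le> 0"
      using decseq_ge[OF \<eta>_gap_decseq \<eta>_gap_lim, OF w w, of "nat (- k)"] by simp
    then show "\<eta>_loss \<omega> = 0" using \<eta>_loss_nonneg[OF w] by simp
  qed
  then have "AE \<omega> in P. \<omega> \<in> space P - lossless \<longrightarrow> \<xi>_loss \<omega> = 0"
    using loss_zero_transfer[OF complement_almost_invariant[OF lossless_almost_invariant]] by blast
  \<comment> \<open>Outside \<open>lossless\<close> all integer shifts also lie outside, so there
    would be no loss at any integer time, contrary to the definition of
    \<open>lossless\<close>.\<close>
  then have "AE \<omega> in P. \<forall>k::int. \<theta> k \<omega> \<in> space P - lossless \<longrightarrow> \<xi>_loss (\<theta> k \<omega>) = 0"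
    by (rule AE_flow_int)
  then show ?thesis
    using AE_space
  proof eventually_elim
    case (elim \<omega>)
    then show ?case
      using lossless_flow_int[OF elim(2)] by (auto simp: lossless_def)
  qed
qed

lemma AE_\<eta>_lossless: "AE \<omega> in P. \<forall>k::int. \<eta>_loss (\<theta> k \<omega>) = 0"
proof (rule AE_flow_int)
  have "AE \<omega> in P. \<omega> \<in> lossless \<longrightarrow> \<xi>_loss \<omega> = 0"
  proof (intro AE_I2 impI)
    fix \<omega> assume "\<omega> \<in> lossless"
    then have "\<omega> \<in> space P" "\<xi>_loss (\<theta> (real_of_int 0) \<omega>) = 0" unfolding lossless_def by blast+
    then show "\<xi>_loss \<omega> = 0" by simp
  qed
  then have "AE \<omega> in P. \<omega> \<in> lossless \<longrightarrow> \<eta>_loss \<omega> = 0"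
    using loss_zero_transfer[OF lossless_almost_invariant] by blast
  then show "AE \<omega> in P. \<eta>_loss \<omega> = 0"
    using AE_lossless by eventually_elim simp
qed

lemma AE_matched:
  "AE \<omega> in P. (AE s in X \<omega>. \<bar>match_time (F \<omega>) s\<bar> \<noteq> \<infinity>) \<and>
    (\<forall>C\<in>sets borel. (\<integral>\<^sup>+ s. indicator (ereal ` C) (match_time (F \<omega>) s) \<partial>X \<omega>) = emeasure (Y \<omega>) C)"
proof -
  have good: "AE \<omega> in P. \<forall>k::int. \<theta> k \<omega> \<notin> N" by (rule AE_flow_int[OF AE_good])
  show ?thesis
    using AE_lossless AE_\<eta>_lossless good AE_good AE_space
  proof eventually_elim
    case (elim \<omega>)
    interpret p: measure_pair "X \<omega>" "Y \<omega>" by (rule pair[OF elim(5)])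
    have vanish: "vanishing_gap (F \<omega>) a a'" if "a \<le> a'" for a a'
      using lossless_iff[of \<omega> 0] elim that by simp
    have "(\<lambda>n. M \<omega> (real k) (real n) - M \<omega> (- real k) (real n)) \<longlonglongrightarrow> 0" for k
      using vanish[of "- real k" "real k"] unfolding vanishing_gap_def
      by (rule filterlim_compose[OF _ filterlim_real_sequentially]) simp
    then have 1: "AE s in X \<omega>. \<bar>match_time (F \<omega>) s\<bar> \<noteq> \<infinity>"
      unfolding F_def by (rule p.match_time_finite_AE)
    have "(\<lambda>n. M \<omega> (real_of_int k - real n) (real_of_int k) - M \<omega> (real_of_int k - real n) (real_of_int k + 1)) \<longlonglongrightarrow> 0" for k :: int
      using \<eta>_loss_shift_iff[OF elim(5,4), of k] elim(2,3) by blast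
    then have "(\<lambda>n. M \<omega> (- real n) b - M \<omega> (- real n) b') \<longlonglongrightarrow> 0" if "b \<le> b'" for b b'
      using that unfolding F_def by (rule p.net.past_gap_vanishes)
    then have "(\<integral>\<^sup>+ s. indicator (ereal ` C) (match_time (F \<omega>) s) \<partial>X \<omega>) = emeasure (Y \<omega>) C"
      if "C \<in> sets borel" for C
      using that unfolding F_def by (rule p.emeasure_match_time)
    with 1 show ?case by blast
  qed
qed

end

section \<open>From paths back to the random measures\<close>

lemma matching_time_eq:
  assumes "diffuse_radon (\<xi> \<omega>)" "diffuse_radon (\<eta> \<omega>)"
  shows "matching_time \<xi> \<eta> \<omega> = match_time (net (\<xi> \<omega>) (\<eta> \<omega>))"
proof
  fix s
  have "emeasure (\<xi> \<omega>) {s..t} = emeasure (\<eta> \<omega>) {s..t} \<longleftrightarrow> net (\<xi> \<omega>) (\<eta> \<omega>) t = net (\<xi> \<omega>) (\<eta> \<omega>) s"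
    if "s < t" for t
    using that diffuse_radon.cumul_mono[OF assms(1), of s t] diffuse_radon.cumul_mono[OF assms(2), of s t]
    by (auto simp: diffuse_radon.emeasure_Icc_cumul[OF assms(1)] diffuse_radon.emeasure_Icc_cumul[OF assms(2)] net_def)
  then have "{t. t > s \<and> emeasure (\<xi> \<omega>) {s..t} = emeasure (\<eta> \<omega>) {s..t}} =
      {t. s < t \<and> net (\<xi> \<omega>) (\<eta> \<omega>) t = net (\<xi> \<omega>) (\<eta> \<omega>) s}"
    by blast
  then show "matching_time \<xi> \<eta> \<omega> s = match_time (net (\<xi> \<omega>) (\<eta> \<omega>)) s"
    unfolding matching_time_def match_time_def by simp
qed

lemma matching_time_shift:
  assumes "\<And>C. C \<in> sets borel \<Longrightarrow> emeasure (\<xi> (\<theta> t \<omega>)) ((\<lambda>x. x - t) ` C) = emeasure (\<xi> \<omega>) C"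
    and "\<And>C. C \<in> sets borel \<Longrightarrow> emeasure (\<eta> (\<theta> t \<omega>)) ((\<lambda>x. x - t) ` C) = emeasure (\<eta> \<omega>) C"
  shows "matching_time \<xi> \<eta> (\<theta> t \<omega>) (s - t) = matching_time \<xi> \<eta> \<omega> s - ereal t"
proof -
  let ?S = "{r. s < r \<and> emeasure (\<xi> \<omega>) {s..r} = emeasure (\<eta> \<omega>) {s..r}}"
  have "{r. s - t < r \<and> emeasure (\<xi> (\<theta> t \<omega>)) {s - t..r} = emeasure (\<eta> (\<theta> t \<omega>)) {s - t..r}} = (\<lambda>x. x - t) ` ?S"
  proof -
    have "emeasure (\<xi> (\<theta> t \<omega>)) {s - t..r} = emeasure (\<xi> \<omega>) {s..r + t}"
      "emeasure (\<eta> (\<theta> t \<omega>)) {s - t..r} = emeasure (\<eta> \<omega>) {s..r + t}" for r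
      using assms[of "{s..r + t}"] by (simp_all add: image_minus_const_atLeastAtMost')
    then have "{r. s - t < r \<and> emeasure (\<xi> (\<theta> t \<omega>)) {s - t..r} = emeasure (\<eta> (\<theta> t \<omega>)) {s - t..r}} = {r. r + t \<in> ?S}"
      by (auto simp: diff_less_eq)
    also have "\<dots> = (\<lambda>x. x - t) ` ?S"
      by (force simp: image_iff)
    finally show ?thesis .
  qed
  then have "matching_time \<xi> \<eta> (\<theta> t \<omega>) (s - t) = Inf ((\<lambda>x. x - ereal t) ` ereal ` ?S)"
    unfolding matching_time_def by (simp add: image_image)
  also have "\<dots> = Inf (ereal ` ?S) - ereal t"
  proof (rule antisym)
    \<comment> \<open>Moving the finite number \<open>t\<close> across the inequality is valid at
      infinite values too, so the empty set of return times needs no separate case.\<close>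
    have iff: "x \<le> y - ereal t \<longleftrightarrow> x + ereal t \<le> y" for x y
      by (cases x; cases y) auto
    show "Inf ((\<lambda>x. x - ereal t) ` ereal ` ?S) \<le> Inf (ereal ` ?S) - ereal t"
      unfolding iff
    proof (rule Inf_greatest)
      fix x assume "x \<in> ereal ` ?S"
      then have "Inf ((\<lambda>x. x - ereal t) ` ereal ` ?S) \<le> x - ereal t"
        by (intro Inf_lower imageI)
      then show "Inf ((\<lambda>x. x - ereal t) ` ereal ` ?S) + ereal t \<le> x"
        unfolding iff .
    qed
    show "Inf (ereal ` ?S) - ereal t \<le> Inf ((\<lambda>x. x - ereal t) ` ereal ` ?S)"
      by (intro INF_greatest ereal_minus_mono Inf_lower order_refl)
  qed
  finally show ?thesis unfolding matching_time_def .
qed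

lemma modified_kernel_measurable:
  assumes "N \<in> sets P" "C \<in> sets borel" "(\<lambda>\<omega>. emeasure (\<zeta> \<omega>) C) \<in> borel_measurable P"
  shows "(\<lambda>\<omega>. emeasure (if \<omega> \<in> N then null_measure borel else \<zeta> \<omega>) C) \<in> borel_measurable P"
proof -
  have "(\<lambda>\<omega>. if \<omega> \<in> N then 0 else emeasure (\<zeta> \<omega>) C) \<in> borel_measurable P"
    using assms by measurable
  also have "(\<lambda>\<omega>. if \<omega> \<in> N then 0 else emeasure (\<zeta> \<omega>) C) =
      (\<lambda>\<omega>. emeasure (if \<omega> \<in> N then null_measure borel else \<zeta> \<omega>) C)"
    by auto
  finally show ?thesis .
qed

lemma diffuse_radonI:
  assumes "sets \<mu> = sets borel" "\<And>C. compact C \<Longrightarrow> emeasure \<mu> C < \<infinity>" "\<And>x. emeasure \<mu> {x} = 0"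
  shows "diffuse_radon \<mu>"
  using assms by unfold_locales auto

theorem theorem5p1:
  fixes P :: "'w measure"
    and \<theta> :: "real \<Rightarrow> 'w \<Rightarrow> 'w"
    and \<xi> \<eta> :: "'w \<Rightarrow> real measure"
  assumes "sigma_finite_measure P"
    and "measurable_flow P \<theta>"
    and "stationary P \<theta>"
    and "random_measure P \<xi>" and "random_measure P \<eta>"
    and "invariant_random_measure P \<theta> \<xi>" and "invariant_random_measure P \<theta> \<eta>"
    and "orthogonal_measures P \<xi> \<eta>"
    and "diffuse P \<xi>" and "diffuse P \<eta>"
    and "intensity P \<xi> < \<infinity>" and "intensity P \<eta> < \<infinity>"
    and "equal_conditional_intensities P \<theta> \<xi> \<eta>"
    and "zero_or_infinite_mass P \<xi>"
  shows "allocation_rule P \<theta> (matching_time \<xi> \<eta>) \<and>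
    (AE \<omega> in P. AE s in \<xi> \<omega>. \<bar>matching_time \<xi> \<eta> \<omega> s\<bar> \<noteq> \<infinity>) \<and>
    balances P (matching_time \<xi> \<eta>) \<xi> \<eta>"
proof -
  note defs = random_measure_def invariant_random_measure_def orthogonal_measures_def diffuse_def
    intensity_def equal_conditional_intensities_def zero_or_infinite_mass_def
  note assms' = assms[unfolded defs]
  \<comment> \<open>Gathers the almost sure properties, with invariance for all times
    \<open>t\<close> simultaneously, so that a single null set \<open>N\<close> covers every
    exception.\<close>
  define Good where "Good \<omega> \<longleftrightarrow> measure_pair (\<xi> \<omega>) (\<eta> \<omega>) \<and>
    (\<forall>t. \<forall>C\<in>sets borel. emeasure (\<xi> (\<theta> t \<omega>)) ((\<lambda>x. x - t) ` C) = emeasure (\<xi> \<omega>) C) \<and>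
    (\<forall>t. \<forall>C\<in>sets borel. emeasure (\<eta> (\<theta> t \<omega>)) ((\<lambda>x. x - t) ` C) = emeasure (\<eta> \<omega>) C)" for \<omega>
  have \<xi>_meas: "(\<lambda>\<omega>. emeasure (\<xi> \<omega>) C) \<in> borel_measurable P"
    and \<eta>_meas: "(\<lambda>\<omega>. emeasure (\<eta> \<omega>) C) \<in> borel_measurable P" if "C \<in> sets borel" for C
    using assms'(4,5) that by blast+
  have "AE \<omega> in P. \<forall>C. compact C \<longrightarrow> emeasure (\<xi> \<omega>) C < \<infinity>"
    "AE \<omega> in P. \<forall>C. compact C \<longrightarrow> emeasure (\<eta> \<omega>) C < \<infinity>"
    using assms'(4,5) by blast+
  then have "AE \<omega> in P. Good \<omega>"
    using assms'(6-10) AE_space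
  proof eventually_elim
    case (elim \<omega>)
    have "diffuse_radon (\<xi> \<omega>)" "diffuse_radon (\<eta> \<omega>)"
      using assms'(4,5) elim by (auto intro!: diffuse_radonI)
    then have "measure_pair (\<xi> \<omega>) (\<eta> \<omega>)"
      using elim by (intro measure_pair.intro measure_pair_axioms.intro)
    then show ?case using elim unfolding Good_def by blast
  qed
  then obtain N where N: "N \<in> null_sets P" "{\<omega> \<in> space P. \<not> Good \<omega>} \<subseteq> N"
    by (auto elim!: AE_E simp: null_sets_def)
  have good: "Good \<omega>" if "\<omega> \<in> space P" "\<omega> \<notin> N" for \<omega> using N(2) that by blast
  \<comment> \<open>On \<open>N\<close> both kernels become the null measure, which forms a valid
    pair with itself; all pathwise hypotheses then hold everywhere.\<close>
  define X where "X \<omega> = (if \<omega> \<in> N then null_measure borel else \<xi> \<omega>)" for \<omega>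
  define Y where "Y \<omega> = (if \<omega> \<in> N then null_measure borel else \<eta> \<omega>)" for \<omega>
  have notN: "AE \<omega> in P. \<omega> \<notin> N" using N(1) by (rule AE_not_in)
  have int_eq: "(\<integral>\<^sup>+ \<omega>. g \<omega> * emeasure (X \<omega>) {0..1} \<partial>P) = (\<integral>\<^sup>+ \<omega>. g \<omega> * emeasure (\<xi> \<omega>) {0..1} \<partial>P)"
    "(\<integral>\<^sup>+ \<omega>. g \<omega> * emeasure (Y \<omega>) {0..1} \<partial>P) = (\<integral>\<^sup>+ \<omega>. g \<omega> * emeasure (\<eta> \<omega>) {0..1} \<partial>P)"
    for g :: "'w \<Rightarrow> ennreal"
    by (intro nn_integral_cong_AE AE_mp[OF notN AE_I2]; simp add: X_def Y_def)+
  have null_pair: "measure_pair (null_measure borel) (null_measure borel)"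
    by unfold_locales auto
  interpret stationary_flow P \<theta>
    using assms(1-3) by (intro stationary_flow.intro stationary_flow_axioms.intro)
  interpret C: coupled_measures P \<theta> X Y N
  proof (intro coupled_measures.intro coupled_measures_axioms.intro stationary_flow_axioms)
    show "measure_pair (X \<omega>) (Y \<omega>)" if "\<omega> \<in> space P" for \<omega>
      using good[OF that] null_pair by (simp add: X_def Y_def Good_def)
    show "N \<in> null_sets P" by (rule N)
    show "(\<lambda>\<omega>. emeasure (X \<omega>) C) \<in> borel_measurable P" "(\<lambda>\<omega>. emeasure (Y \<omega>) C) \<in> borel_measurable P"
      if "C \<in> sets borel" for C
      unfolding X_def Y_def using N(1) that \<xi>_meas \<eta>_meas by (auto intro!: modified_kernel_measurable)
    show "emeasure (X (\<theta> t \<omega>)) ((\<lambda>x. x - t) ` C) = emeasure (X \<omega>) C"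
      "emeasure (Y (\<theta> t \<omega>)) ((\<lambda>x. x - t) ` C) = emeasure (Y \<omega>) C"
      if "\<omega> \<in> space P" "\<omega> \<notin> N" "\<theta> t \<omega> \<notin> N" "C \<in> sets borel" for \<omega> t C
      using good[OF that(1,2)] that by (simp_all add: X_def Y_def Good_def)
    show "(\<integral>\<^sup>+ \<omega>. emeasure (X \<omega>) {0..1} \<partial>P) < \<infinity>" "(\<integral>\<^sup>+ \<omega>. emeasure (Y \<omega>) {0..1} \<partial>P) < \<infinity>"
      using assms'(11,12) int_eq[of "\<lambda>_. 1"] by simp_all
    show "(\<integral>\<^sup>+ \<omega>. indicator A \<omega> * emeasure (X \<omega>) {0..1} \<partial>P) =
        (\<integral>\<^sup>+ \<omega>. indicator A \<omega> * emeasure (Y \<omega>) {0..1} \<partial>P)" if "A \<in> invariant_sets P \<theta>" for A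
      unfolding int_eq using assms'(13) that by blast
    show "AE \<omega> in P. emeasure (X \<omega>) UNIV \<in> {0, \<infinity>}"
      using assms'(14) notN by eventually_elim (simp add: X_def)
  qed
  have eq: "matching_time \<xi> \<eta> \<omega> = match_time (C.F \<omega>)" "X \<omega> = \<xi> \<omega>" "Y \<omega> = \<eta> \<omega>"
    if "\<omega> \<in> space P" "\<omega> \<notin> N" for \<omega>
    using that C.X_radon[of \<omega>] C.Y_radon[of \<omega>]
    by (simp_all add: C.F_def X_def Y_def matching_time_eq)
  have "allocation_rule P \<theta> (matching_time \<xi> \<eta>)"
    unfolding allocation_rule_def
  proof (intro conjI bexI[OF _ N(1)])
    let ?R = "restrict_space P (space P - N)"
    have space: "space ?R = space P - N" by (auto simp: space_restrict_space)
    have id: "(\<lambda>\<omega>. \<omega>) \<in> measurable ?R P"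
      by (rule measurable_restrict_space1) simp
    have "(\<lambda>x. (fst x, snd x)) \<in> measurable (?R \<Otimes>\<^sub>M borel) (P \<Otimes>\<^sub>M (borel :: real measure))"
      by (intro measurable_Pair measurable_snd measurable_compose[OF measurable_fst id])
    then have "(\<lambda>x. match_time (C.F (fst x)) (snd x)) \<in> borel_measurable (?R \<Otimes>\<^sub>M borel)"
      using measurable_compose[OF _ C.F.match_time_measurable] by (simp add: split_beta')
    then show "(\<lambda>(\<omega>, s). matching_time \<xi> \<eta> \<omega> s) \<in> borel_measurable (?R \<Otimes>\<^sub>M borel)"
      by (rule measurable_cong[THEN iffD1, rotated]) (auto simp: space_pair_measure space eq)
    show "AE \<omega> in P. \<forall>s t. matching_time \<xi> \<eta> (\<theta> t \<omega>) (s - t) = matching_time \<xi> \<eta> \<omega> s - ereal t"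
      using notN AE_space
    proof (eventually_elim, intro allI)
      \<comment> \<open>The original kernels are used here: \<open>Good \<omega>\<close> controls
        them along the whole orbit, even at times when it visits \<open>N\<close>.\<close>
      fix \<omega> s t assume "\<omega> \<notin> N" "\<omega> \<in> space P"
      then show "matching_time \<xi> \<eta> (\<theta> t \<omega>) (s - t) = matching_time \<xi> \<eta> \<omega> s - ereal t"
        using good[of \<omega>] unfolding Good_def by (intro matching_time_shift) blast+
    qed
  qed
  moreover have "AE \<omega> in P. AE s in \<xi> \<omega>. \<bar>matching_time \<xi> \<eta> \<omega> s\<bar> \<noteq> \<infinity>"
    using C.AE_matched notN AE_space
  proof eventually_elim
    case (elim \<omega>)
    from elim(1) show ?case unfolding eq[OF elim(3,2)] by blast
  qed
  moreover have "balances P (matching_time \<xi> \<eta>) \<xi> \<eta>"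
    unfolding balances_def using C.AE_matched notN AE_space
  proof eventually_elim
    case (elim \<omega>)
    from elim(1) show ?case unfolding eq[OF elim(3,2)] by blast
  qed
  ultimately show ?thesis by blast
qed

end
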